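(* Let $P$ be a set of $n$ points in $\mathbb{R}^d$ and let $L$ be a set of lines so that each line contains at least $r$ points of $P$. There is a constant $K$, dependent only on $d$, so that if $$|L|\ \ge\ K\,\frac{n^2}{r^{d+1}},$$ then there exists a hypersurface of degree at most $\frac{r}{4}$ containing at least $4\,\frac{n^2}{r^{d+1}}$ lines of $L$.
   Context: Lines are affine lines in $\mathbb{R}^d$, and $|L|$ denotes the number of lines in $L$. A hypersurface of degree at most $D$ in $\mathbb{R}^d$ means the zero set $\{x\in\mathbb{R}^d : f(x)=0\}$ of a non-zero polynomial $f\in\mathbb{R}[x_1,\dots,x_d]$ of degree at most $D$; it contains a line if the line is a subset of this zero set.
   Formalization: The formal statement takes r to be an integer with r ≥ 2; for r = 1 the claim fails (one point and many lines through it, where a hypersurface of degree at most 1/4 is empty), and for r = 0 the bound is undefined. *)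

theory Defs
  imports "HOL-Analysis.Analysis" "HOL-Library.Poly_Mapping"
begin

definition is_line :: "(real ^ 'd) set \<Rightarrow> bool" where
  "is_line l \<longleftrightarrow> affine l \<and> aff_dim l = 1"

text \<open>Formal polynomials over the reals in the variables \<open>x\<^sub>i\<close>, \<open>i :: 'd\<close>: a monomial is the
  finitely supported map of its exponents, a polynomial the finitely supported map of its
  coefficients. In particular \<open>f \<noteq> 0\<close> means that some coefficient is non-zero.\<close>
type_synonym 'd mpolynomial = "('d \<Rightarrow>\<^sub>0 nat) \<Rightarrow>\<^sub>0 real"

definition monom_degree :: "('d::finite \<Rightarrow>\<^sub>0 nat) \<Rightarrow> nat" where
  "monom_degree m = (\<Sum>i\<in>UNIV. Poly_Mapping.lookup m i)"

text \<open>The zero polynomial gets total degree 0.\<close>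
definition total_degree :: "'d::finite mpolynomial \<Rightarrow> nat" where
  "total_degree f = Max (insert 0 (monom_degree ` Poly_Mapping.keys f))"

definition eval_mpoly :: "'d::finite mpolynomial \<Rightarrow> real ^ 'd \<Rightarrow> real" where
  "eval_mpoly f x = (\<Sum>m\<in>Poly_Mapping.keys f. Poly_Mapping.lookup f m * (\<Prod>i\<in>UNIV. (x $ i) ^ Poly_Mapping.lookup m i))"

text \<open>The degree bound is a real number because it need not be integral. A non-zero constant
  polynomial is allowed, so the empty set is a hypersurface of degree at most \<open>D\<close> for all \<open>D \<ge> 0\<close>.\<close>
definition hypersurface_of_degree_at_most :: "real \<Rightarrow> (real ^ 'd::finite) set \<Rightarrow> bool" where
  "hypersurface_of_degree_at_most D H \<longleftrightarrow>
     (\<exists>f :: 'd mpolynomial. f \<noteq> 0 \<and> real (total_degree f) \<le> D \<and> H = {x. eval_mpoly f x = 0})"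

end

theory Submission
  imports Defs "HOL-Homology.Invariance_of_Domain"
begin

text \<open>Polynomial partitioning, with \<open>d\<close> the dimension. For \<open>k\<close> with \<open>8 d\<^sup>2 2\<^sup>k \<le> r < 16 d\<^sup>2 2\<^sup>k\<close> there is a
  polynomial of degree at most \<open>D = 2 d\<^sup>2 2\<^sup>k \<le> r/4\<close> whose zero set cuts \<open>P\<close> into \<open>2\<^bsup>dk\<^esup>\<close> cells with at most
  \<open>n / 2\<^bsup>dk\<^esup>\<close> points each. A line outside the zero set meets it at most \<open>D\<close> times, hence has at least
  \<open>r - 2D - 1 \<ge> r/4\<close> pairs of points in a common cell, whereas the total number of such pairs is at
  most \<open>n\<^sup>2 / 2\<^bsup>dk\<^esup> = O(n\<^sup>2 / r\<^sup>d)\<close>. So only \<open>O(n\<^sup>2 / r\<^bsup>d+1\<^esup>)\<close> lines lie outside the zero set. For \<open>r < 8 d\<^sup>2\<close> the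
  trivial bound \<open>|L| \<le> n\<^sup>2\<close> contradicts the hypothesis for large \<open>K\<close>, unless \<open>n = 0\<close>.

  The partition comes from a discrete ham sandwich theorem, for which the Borsuk--Ulam theorem is
  needed only for piecewise linear maps. There, general position is linear algebra and the
  library's mod 2 degree comparison \<open>Borsuk_odd_mapping_degree_step\<close> gives an induction on the
  dimension.\<close>

section \<open>A piecewise linear Borsuk--Ulam theorem\<close>

text \<open>Points are sequences vanishing beyond index \<open>n\<close>, as in
  \<open>nsphere\<close>. The equator of \<open>coord_sphere (Suc n)\<close> is then literally
  \<open>coord_sphere n\<close>.\<close>

definition coord_sphere :: "nat \<Rightarrow> (nat \<Rightarrow> real) set" where
  "coord_sphere n = {x. (\<Sum>i\<le>n. (x i)\<^sup>2) = 1 \<and> (\<forall>i>n. x i = 0)}"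

lemma nsphere_eq_top_of_set: "nsphere n = top_of_set (coord_sphere n)"
  by (simp add: nsphere coord_sphere_def euclidean_product_topology)

lemma topspace_nsphere_eq: "topspace (nsphere n) = coord_sphere n"
  by (simp add: nsphere_eq_top_of_set)

definition normalize_map :: "nat \<Rightarrow> ('a \<Rightarrow> nat \<Rightarrow> real) \<Rightarrow> 'a \<Rightarrow> nat \<Rightarrow> real" where
  "normalize_map n h x i = h x i / sqrt (\<Sum>j\<le>n. (h x j)\<^sup>2)"

lemma sum_squares_pos:
  fixes y :: "nat \<Rightarrow> real"
  assumes "\<exists>i\<le>n. y i \<noteq> 0"
  shows "(\<Sum>j\<le>n. (y j)\<^sup>2) > 0"
  using assms by (metis atMost_iff finite_atMost sum_pos2 zero_le_power2 zero_less_power2)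

lemma normalize_map_sphere:
  assumes "\<exists>i\<le>n. h x i \<noteq> 0" "\<forall>i>n. h x i = 0"
  shows "normalize_map n h x \<in> coord_sphere n"
  using assms sum_squares_pos[of n "h x"]
  by (simp add: coord_sphere_def normalize_map_def power_divide flip: sum_divide_distrib)

lemma continuous_on_normalize_map:
  assumes "\<And>i. continuous_on S (\<lambda>x. h x i)" "\<And>x. x \<in> S \<Longrightarrow> \<exists>i\<le>n. h x i \<noteq> 0"
  shows "continuous_on S (normalize_map n h)"
  unfolding normalize_map_def
  apply (intro continuous_on_coordinatewise_then_product continuous_intros assms)
  using assms(2) sum_squares_pos[of n "h _"] by fastforce

lemma continuous_map_normalize_map:
  assumes "\<And>i. continuous_on (coord_sphere m) (\<lambda>x. h x i)"
    "\<And>x. x \<in> coord_sphere m \<Longrightarrow> (\<exists>i\<le>n. h x i \<noteq> 0) \<and> (\<forall>i>n. h x i = 0)"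
  shows "continuous_map (nsphere m) (nsphere n) (normalize_map n h)"
  using assms by (auto simp: nsphere_eq_top_of_set intro!: continuous_on_normalize_map normalize_map_sphere)

text \<open>By \<open>nz\<close> the segment from \<open>h x\<close> to \<open>k x\<close> avoids
  the origin, so the straight-line homotopy can be projected radially to the sphere.\<close>

lemma homotopic_normalize_map:
  assumes h: "\<And>i. continuous_on (coord_sphere n) (\<lambda>x. h x i)"
    and k: "\<And>i. continuous_on (coord_sphere n) (\<lambda>x. k x i)"
    and 0: "\<And>x i. x \<in> coord_sphere n \<Longrightarrow> i > n \<Longrightarrow> h x i = 0 \<and> k x i = 0"
    and nz: "\<And>x t. x \<in> coord_sphere n \<Longrightarrow> 0 \<le> t \<Longrightarrow> t \<le> 1 \<Longrightarrow> \<exists>i\<le>n. (1 - t) * h x i + t * k x i \<noteq> 0"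
  shows "homotopic_with (\<lambda>_. True) (nsphere n) (nsphere n) (normalize_map n h) (normalize_map n k)"
proof -
  let ?S = "coord_sphere n"
  define H where "H = (\<lambda>p :: real \<times> (nat \<Rightarrow> real). \<lambda>i. (1 - fst p) * h (snd p) i + fst p * k (snd p) i)"
  have snd_h: "continuous_on ({0..1} \<times> ?S) (\<lambda>p. h (snd p) i)" for i
    by (rule continuous_on_compose2[OF h]) (auto intro: continuous_intros)
  have snd_k: "continuous_on ({0..1} \<times> ?S) (\<lambda>p. k (snd p) i)" for i
    by (rule continuous_on_compose2[OF k]) (auto intro: continuous_intros)
  have "continuous_on ({0..1} \<times> ?S) (normalize_map n H)"
    using nz by (intro continuous_on_normalize_map)
      (auto simp: H_def intro!: continuous_intros snd_h snd_k)
  moreover have "normalize_map n H p \<in> ?S" if "p \<in> {0..1} \<times> ?S" for p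
    using that nz 0 by (intro normalize_map_sphere) (auto simp: H_def)
  ultimately show ?thesis
    unfolding nsphere_eq_top_of_set homotopic_with_def
    by (intro exI[of _ "normalize_map n H"]) (auto simp: normalize_map_def H_def)
qed

section \<open>General position by linear algebra\<close>

lemma homogeneous_system_nontrivial:
  fixes a :: "'i \<Rightarrow> 'j \<Rightarrow> real"
  assumes "finite I" "finite J" "card J < card I"
  shows "\<exists>c. (\<exists>i\<in>I. c i \<noteq> 0) \<and> (\<forall>j\<in>J. (\<Sum>i\<in>I. c i * a i j) = 0)"
  using assms(2,1,3)
proof (induction J arbitrary: I a rule: finite_induct)
  case empty
  then have "I \<noteq> {}" by auto
  then show ?case by (intro exI[of _ "\<lambda>_. 1"]) auto
next
  case (insert j J)
  show ?case
  proof (cases "\<forall>i\<in>I. a i j = 0")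
    case True
    have "card J < card I" using insert by simp
    with insert.IH[of I a] insert.prems obtain c where
      "\<exists>i\<in>I. c i \<noteq> 0" "\<forall>j\<in>J. (\<Sum>i\<in>I. c i * a i j) = 0" by auto
    with True show ?thesis by (intro exI[of _ c]) auto
  next
    case False
    then obtain i0 where i0: "i0 \<in> I" "a i0 j \<noteq> 0" by auto
    let ?I = "I - {i0}"
    \<comment> \<open>Solving equation \<open>j\<close> for the unknown \<open>i0\<close> and
      substituting into the other equations gives the coefficients \<open>b\<close>;
      \<open>- s\<close> is the resulting value of that unknown.\<close>
    define b where "b i j' = a i j' - a i j / a i0 j * a i0 j'" for i j'
    have "card J < card ?I" using insert i0 by simp
    with insert.IH[of ?I b] insert.prems obtain c where
      c: "\<exists>i\<in>?I. c i \<noteq> 0" "\<And>j'. j' \<in> J \<Longrightarrow> (\<Sum>i\<in>?I. c i * b i j') = 0" by auto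
    define s where "s = (\<Sum>i\<in>?I. c i * a i j) / a i0 j"
    define c' where "c' i = (if i = i0 then - s else c i)" for i
    have split: "(\<Sum>i\<in>I. c' i * a i j') = - s * a i0 j' + (\<Sum>i\<in>?I. c i * a i j')" for j'
      using insert.prems i0 by (subst sum.remove[of _ i0]) (auto simp: c'_def intro!: sum.cong)
    have "(\<Sum>i\<in>?I. c i * b i j') = (\<Sum>i\<in>?I. c i * a i j') - s * a i0 j'" for j'
      by (simp add: b_def s_def algebra_simps sum_subtractf sum_distrib_left sum_divide_distrib sum_distrib_right)
    with c(2) have "(\<Sum>i\<in>I. c' i * a i j') = 0" if "j' \<in> J" for j'
      using that split[of j'] by fastforce
    moreover have "(\<Sum>i\<in>I. c' i * a i j) = 0"
      using split[of j] i0 by (simp add: s_def)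
    moreover have "\<exists>i\<in>I. c' i \<noteq> 0" using c(1) by (auto simp: c'_def)
    ultimately show ?thesis by blast
  qed
qed

text \<open>On the moment curve, the linear form of a non-zero \<open>c\<close> is a non-zero
  univariate polynomial, so finitely many forms have finitely many roots in all. The reversed
  exponent \<open>n - i\<close> gives the point last coordinate 1, which normalises the direction of
  projection later.\<close>

lemma exists_moment_curve_point:
  fixes C :: "(nat \<Rightarrow> real) set"
  assumes "finite C" "\<And>c. c \<in> C \<Longrightarrow> \<exists>i\<le>n. c i \<noteq> 0"
  obtains t :: real where "\<And>c. c \<in> C \<Longrightarrow> (\<Sum>i\<le>n. c i * t ^ (n - i)) \<noteq> 0"
proof -
  define p where "p c = (\<Sum>i\<le>n. Polynomial.monom (c i) (n - i))" for c :: "nat \<Rightarrow> real"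
  have pc: "poly (p c) t = (\<Sum>i\<le>n. c i * t ^ (n - i))" for c t
    by (simp add: p_def poly_sum poly_monom)
  have "Polynomial.coeff (p c) (n - i) = c i" if "i \<le> n" for c i
  proof -
    have "Polynomial.coeff (p c) (n - i) = (\<Sum>j\<le>n. if j = i then c j else 0)"
      unfolding p_def coeff_sum using that by (intro sum.cong) (auto simp: coeff_monom)
    with that show ?thesis by simp
  qed
  then have "p c \<noteq> 0" if "c \<in> C" for c
    using assms(2)[OF that] by (metis coeff_0)
  then have "finite (\<Union>c\<in>C. {t. poly (p c) t = 0})"
    using assms(1) by (intro finite_UN_I poly_roots_finite) auto
  then obtain t where "t \<notin> (\<Union>c\<in>C. {t. poly (p c) t = 0})"
    using ex_new_if_finite infinite_UNIV_char_0 by blast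
  with that pc show thesis by auto
qed

section \<open>Odd degree by induction on the dimension\<close>

lemma coord_sphere_0_cases:
  assumes "x \<in> coord_sphere 0"
  shows "x = (\<lambda>i. if i = 0 then 1 else 0) \<or> x = (\<lambda>i. if i = 0 then - 1 else 0)"
  using assms by (auto simp: coord_sphere_def power2_eq_1_iff fun_eq_iff)

lemma coord_sphere_Suc_equator: "x \<in> coord_sphere n \<longleftrightarrow> x \<in> coord_sphere (Suc n) \<and> x (Suc n) = 0"
proof -
  have "x i = 0" if "x (Suc n) = 0" "\<forall>i>Suc n. x i = 0" "i > n" for i
    using that Suc_lessI[of n i] by metis
  then show ?thesis by (auto simp: coord_sphere_def)
qed

text \<open>The sphere has two points, so an odd normalised map is the identity or the reflection,
  of degree 1 or -1.\<close>

lemma odd_degree_nsphere_0: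
  assumes odd: "\<And>x i. x \<in> coord_sphere 0 \<Longrightarrow> h (\<lambda>i. - x i) i = - h x i"
    and zero: "\<And>x i. x \<in> coord_sphere 0 \<Longrightarrow> i > 0 \<Longrightarrow> h x i = 0"
    and nz: "\<And>x. x \<in> coord_sphere 0 \<Longrightarrow> h x 0 \<noteq> 0"
  shows "odd (Brouwer_degree2 0 (normalize_map 0 h))"
proof -
  obtain v :: "nat \<Rightarrow> real" where v: "\<And>i. v i = (if i = 0 then 1 else 0)" by simp
  have vS: "v \<in> coord_sphere 0" by (simp add: v coord_sphere_def)
  have cases: "x = v \<or> x = (\<lambda>i. - v i)" if "x \<in> coord_sphere 0" for x
    using coord_sphere_0_cases[OF that] by (auto simp: v fun_eq_iff)
  have nm: "normalize_map 0 h x = (\<lambda>i. if i = 0 then sgn (h x 0) else 0)" if "x \<in> coord_sphere 0" for x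
    using zero[OF that] nz[OF that] by (auto simp: normalize_map_def fun_eq_iff sgn_if)
  show ?thesis
  proof (cases "h v 0 > 0")
    case True
    have "normalize_map 0 h x = id x" if "x \<in> topspace (nsphere 0)" for x
    proof -
      have x: "x \<in> coord_sphere 0" using that by (simp add: topspace_nsphere_eq)
      show ?thesis
        using cases[OF x]
      proof
        assume "x = v"
        then have "normalize_map 0 h x = (\<lambda>i. if i = 0 then sgn (h v 0) else 0)" using nm[OF vS] by simp
        with True \<open>x = v\<close> show ?thesis by (simp add: v fun_eq_iff)
      next
        assume "x = (\<lambda>i. - v i)"
        moreover from this have "h x 0 = - h v 0" using odd[OF vS, of 0] by simp
        ultimately show ?thesis using nm[OF x] True by (simp add: v fun_eq_iff)
      qed
    qed
    then have "Brouwer_degree2 0 (normalize_map 0 h) = Brouwer_degree2 0 id"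
      by (rule Brouwer_degree2_eq)
    then show ?thesis by simp
  next
    case False
    with nz[OF vS] have "h v 0 < 0" by simp
    then have "normalize_map 0 h x = (\<lambda>i. if i = 0 then - x i else x i)" if "x \<in> topspace (nsphere 0)" for x
    proof -
      have x: "x \<in> coord_sphere 0" using that by (simp add: topspace_nsphere_eq)
      show ?thesis
        using cases[OF x]
      proof
        assume "x = v"
        then have "normalize_map 0 h x = (\<lambda>i. if i = 0 then sgn (h v 0) else 0)" using nm[OF vS] by simp
        with \<open>h v 0 < 0\<close> \<open>x = v\<close> show ?thesis by (simp add: v fun_eq_iff)
      next
        assume "x = (\<lambda>i. - v i)"
        moreover from this have "h x 0 = - h v 0" using odd[OF vS, of 0] by simp
        ultimately show ?thesis using nm[OF x] \<open>h v 0 < 0\<close> by (simp add: v fun_eq_iff)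
      qed
    qed
    then have "Brouwer_degree2 0 (normalize_map 0 h) = Brouwer_degree2 0 (\<lambda>x i. if i = 0 then - x i else x i)"
      by (rule Brouwer_degree2_eq)
    then show ?thesis by (simp add: Brouwer_degree2_reflection)
  qed
qed

text \<open>Induction on \<open>n\<close>: \<open>h\<close> is deformed to an odd map preserving the
  equator, whose degree has the parity of the degree of its restriction to the equator. That
  restriction comes from projecting \<open>h\<close> along a generic direction, so it is again
  piecewise linear. Hypothesis \<open>sel\<close> expresses piecewise linearity without describing
  the pieces.\<close>

theorem odd_Brouwer_degree_piecewise_linear:
  fixes h :: "(nat \<Rightarrow> real) \<Rightarrow> nat \<Rightarrow> real" and A :: "(nat \<Rightarrow> nat \<Rightarrow> real) set"
  assumes cont: "\<And>i. continuous_on (coord_sphere n) (\<lambda>x. h x i)"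
    and odd: "\<And>x i. x \<in> coord_sphere n \<Longrightarrow> h (\<lambda>i. - x i) i = - h x i"
    and zero: "\<And>x i. x \<in> coord_sphere n \<Longrightarrow> i > n \<Longrightarrow> h x i = 0"
    and nz: "\<And>x. x \<in> coord_sphere n \<Longrightarrow> \<exists>i\<le>n. h x i \<noteq> 0"
    and "finite A"
    and sel: "\<And>x. x \<in> coord_sphere n \<Longrightarrow> \<exists>a\<in>A. \<forall>i\<le>n. h x i = (\<Sum>j\<le>n. a i j * x j)"
  shows "odd (Brouwer_degree2 n (normalize_map n h))"
  using assms
proof (induction n arbitrary: h A)
  case 0
  then show ?case by (intro odd_degree_nsphere_0) auto
next
  case (Suc n)
  let ?N = "Suc n"
  let ?S = "coord_sphere ?N"
  \<comment> \<open>With \<open>n + 2\<close> unknowns and \<open>n + 1\<close> equations there is a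
    non-zero vector \<open>c a\<close> normal to the image under \<open>a\<close> of the hyperplane
    of the equator.\<close>
  have "\<exists>c. (\<exists>i\<in>{..?N}. c i \<noteq> 0) \<and> (\<forall>j\<in>{..n}. (\<Sum>i\<in>{..?N}. c i * a i j) = 0)" for a :: "nat \<Rightarrow> nat \<Rightarrow> real"
    by (rule homogeneous_system_nontrivial) auto
  then obtain c where c: "\<And>a :: nat \<Rightarrow> nat \<Rightarrow> real. \<exists>i\<le>?N. c a i \<noteq> 0"
      "\<And>a j. j \<le> n \<Longrightarrow> (\<Sum>i\<le>?N. c a i * a i j) = 0"
    by (metis atMost_iff)
  obtain t where t: "\<And>d. d \<in> c ` A \<Longrightarrow> (\<Sum>i\<le>?N. d i * t ^ (?N - i)) \<noteq> 0"
    by (rule exists_moment_curve_point[of "c ` A" ?N]) (use Suc.prems c in auto)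
  define q where "q i = t ^ (?N - i)" for i
  have q: "(\<Sum>i\<le>?N. c a i * q i) \<noteq> 0" if "a \<in> A" for a
    using t[of "c a"] that by (simp add: q_def)
  have [simp]: "q ?N = 1" by (simp add: q_def)
  \<comment> \<open>The direction \<open>q\<close> avoids the image of the equator, which lies in finitely many hyperplanes.\<close>
  have avoid: "\<exists>i\<le>n. h x i \<noteq> q i * h x ?N" if x: "x \<in> coord_sphere n" for x
  proof (rule ccontr)
    assume no: "\<not> ?thesis"
    have hq: "h x i = q i * h x ?N" if "i \<le> ?N" for i
      using that no by (cases "i = ?N") auto
    have xS: "x \<in> ?S" "x ?N = 0" using x coord_sphere_Suc_equator by blast+
    obtain a where a: "a \<in> A" "\<And>i. i \<le> ?N \<Longrightarrow> h x i = (\<Sum>j\<le>?N. a i j * x j)"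
      using bexE[OF Suc.prems(6)[OF xS(1)]] by metis
    \<comment> \<open>If \<open>h x\<close> were a multiple of \<open>q\<close>, pairing it with the
      normal \<open>c a\<close> would give both 0 and a non-zero multiple of
      \<open>h x ?N\<close>.\<close>
    have "(\<Sum>i\<le>?N. c a i * q i) * h x ?N = (\<Sum>i\<le>?N. c a i * h x i)"
      unfolding sum_distrib_right by (intro sum.cong refl) (metis hq atMost_iff mult.assoc)
    also have "\<dots> = (\<Sum>i\<le>?N. c a i * (\<Sum>j\<le>n. a i j * x j))"
      using a(2) xS(2) by (intro sum.cong) auto
    also have "\<dots> = (\<Sum>j\<le>n. (\<Sum>i\<le>?N. c a i * a i j) * x j)"
      unfolding sum_distrib_left sum_distrib_right by (subst sum.swap) (simp add: mult.assoc)
    also have "\<dots> = 0" using c(2) by simp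
    finally have "h x ?N = 0" using q[OF a(1)] by simp
    with hq Suc.prems(4)[OF xS(1)] show False by (metis mult_zero_right)
  qed
  \<comment> \<open>The factor \<open>\<bar>x ?N\<bar>\<close> makes \<open>k\<close> preserve the equator. It is even, so \<open>k\<close> stays odd, and the straight-line
    homotopy from \<open>h\<close> to \<open>k\<close> can only vanish on the equator at its end, which \<open>avoid\<close> excludes.\<close>
  define k where "k x i = (if i = ?N then h x ?N * \<bar>x ?N\<bar> else if i \<le> n then h x i - q i * h x ?N else 0)" for x i
  have coord: "continuous_on S (\<lambda>x. x i)" for S :: "(nat \<Rightarrow> real) set" and i
    by (intro continuous_on_product_then_coordinatewise[OF continuous_on_id])
  have contk: "continuous_on ?S (\<lambda>x. k x i)" for i
    unfolding k_def
    by (cases "i = ?N"; cases "i \<le> n"; simp) (intro continuous_intros Suc.prems(1) coord)+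
  have "homotopic_with (\<lambda>_. True) (nsphere ?N) (nsphere ?N) (normalize_map ?N h) (normalize_map ?N k)"
  proof (rule homotopic_normalize_map[OF Suc.prems(1) contk])
    show "h x i = 0 \<and> k x i = 0" if "x \<in> ?S" "i > ?N" for x i
      using that Suc.prems(3) by (auto simp: k_def)
    fix x and \<tau> :: real assume x: "x \<in> ?S" and "0 \<le> \<tau>" "\<tau> \<le> 1"
    show "\<exists>i\<le>?N. (1 - \<tau>) * h x i + \<tau> * k x i \<noteq> 0"
    proof (rule ccontr)
      assume "\<not> ?thesis"
      then have z: "(1 - \<tau>) * h x i + \<tau> * k x i = 0" if "i \<le> ?N" for i using that by auto
      have "h x ?N * ((1 - \<tau>) + \<tau> * \<bar>x ?N\<bar>) = 0"
        using z[of ?N] by (simp add: k_def algebra_simps)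
      then consider "h x ?N = 0" | "(1 - \<tau>) + \<tau> * \<bar>x ?N\<bar> = 0" by auto
      then show False
      proof cases
        case 1
        then have "h x i = 0" if "i \<le> ?N" for i
          using z[of i] that by (cases "i = ?N") (auto simp: k_def algebra_simps)
        with Suc.prems(4)[OF x] show False by auto
      next
        case 2
        then have "1 - \<tau> = 0 \<and> \<tau> * \<bar>x ?N\<bar> = 0"
          using \<open>0 \<le> \<tau>\<close> \<open>\<tau> \<le> 1\<close> by (intro add_nonneg_eq_0_iff[THEN iffD1]) auto
        then have "\<tau> = 1" "x ?N = 0" by auto
        with z have "h x i = q i * h x ?N" if "i \<le> n" for i
          using z[of i] that by (simp add: k_def)
        then show False
          using avoid[of x] x \<open>x ?N = 0\<close> coord_sphere_Suc_equator by blast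
      qed
    qed
  qed
  then have deg_hk: "Brouwer_degree2 ?N (normalize_map ?N h) = Brouwer_degree2 ?N (normalize_map ?N k)"
    and cmk: "continuous_map (nsphere ?N) (nsphere ?N) (normalize_map ?N k)"
    by (auto dest: Brouwer_degree2_homotopic homotopic_with_imp_continuous_maps)
  \<comment> \<open>\<open>k'\<close> is \<open>h\<close> projected along \<open>q\<close> to the
    coordinates up to \<open>n\<close>. On the equator the last coordinate of \<open>k\<close>
    vanishes, so both normalisations agree there.\<close>
  define k' where "k' x i = (if i \<le> n then h x i - q i * h x ?N else 0)" for x i
  have kk': "normalize_map ?N k x = normalize_map n k' x" if "x \<in> coord_sphere n" for x
    using that coord_sphere_Suc_equator[of x n] by (auto simp: fun_eq_iff normalize_map_def k_def k'_def)
  have nzk': "\<exists>i\<le>n. k' x i \<noteq> 0" if "x \<in> coord_sphere n" for x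
    using avoid[OF that] by (auto simp: k'_def)
  have "even (Brouwer_degree2 ?N (normalize_map ?N k) - Brouwer_degree2 (?N - Suc 0) (normalize_map ?N k))"
  proof (rule Borsuk_odd_mapping_degree_step[OF cmk])
    show "(normalize_map ?N k \<circ> (\<lambda>x i. - x i)) u = ((\<lambda>x i. - x i) \<circ> normalize_map ?N k) u"
      if "u \<in> topspace (nsphere ?N)" for u
    proof -
      have "k (\<lambda>i. - u i) i = - k u i" for i
        using Suc.prems(2)[of u] that by (auto simp: k_def topspace_nsphere_eq)
      then show ?thesis by (simp add: normalize_map_def fun_eq_iff)
    qed
    show "normalize_map ?N k \<in> topspace (nsphere (?N - Suc 0)) \<rightarrow> topspace (nsphere (?N - Suc 0))"
      using kk' nzk' by (auto simp: topspace_nsphere_eq k'_def intro!: normalize_map_sphere)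
  qed
  moreover have "Brouwer_degree2 n (normalize_map ?N k) = Brouwer_degree2 n (normalize_map n k')"
    by (rule Brouwer_degree2_eq) (simp add: kk' topspace_nsphere_eq)
  moreover have "odd (Brouwer_degree2 n (normalize_map n k'))"
  proof (rule Suc.IH)
    have sub: "coord_sphere n \<subseteq> ?S" using coord_sphere_Suc_equator by blast+
    show "continuous_on (coord_sphere n) (\<lambda>x. k' x i)" for i
      unfolding k'_def
      by (cases "i \<le> n"; simp) (intro continuous_intros continuous_on_subset[OF Suc.prems(1) sub])
    show "k' (\<lambda>i. - x i) i = - k' x i" if "x \<in> coord_sphere n" for x i
      using Suc.prems(2)[of x] that sub by (auto simp: k'_def)
    show "k' x i = 0" if "i > n" for x i using that by (simp add: k'_def)
    show "\<exists>i\<le>n. k' x i \<noteq> 0" if "x \<in> coord_sphere n" for x using nzk' that .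
    \<comment> \<open>On matrices, projection along \<open>q\<close> subtracts \<open>q i\<close>
      times the last row from row \<open>i\<close>.\<close>
    show "finite ((\<lambda>a i j. a i j - q i * a ?N j) ` A)" using Suc.prems(5) by simp
    show "\<exists>a\<in>(\<lambda>a i j. a i j - q i * a ?N j) ` A. \<forall>i\<le>n. k' x i = (\<Sum>j\<le>n. a i j * x j)"
      if "x \<in> coord_sphere n" for x
    proof -
      have x: "x \<in> ?S" "x ?N = 0" using that coord_sphere_Suc_equator by blast+
      obtain a where a: "a \<in> A" "\<And>i. i \<le> ?N \<Longrightarrow> h x i = (\<Sum>j\<le>?N. a i j * x j)"
        using bexE[OF Suc.prems(6)[OF x(1)]] by metis
      have "k' x i = (\<Sum>j\<le>n. (a i j - q i * a ?N j) * x j)" if "i \<le> n" for i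
        using that a(2)[of i] a(2)[of ?N] x(2)
        by (simp add: k'_def algebra_simps sum_subtractf sum_distrib_left)
      then show ?thesis by (intro bexI[OF _ imageI[OF a(1)]]) simp
    qed
  qed
  ultimately show ?case using deg_hk by simp
qed

text \<open>A map without zeros, padded by a zero coordinate at index \<open>n\<close>, would have a
  normalisation of odd degree. But that normalisation misses a pole, so its degree is 0.\<close>

corollary piecewise_linear_Borsuk_Ulam:
  fixes h :: "(nat \<Rightarrow> real) \<Rightarrow> nat \<Rightarrow> real" and A :: "(nat \<Rightarrow> nat \<Rightarrow> real) set"
  assumes cont: "\<And>i. i < n \<Longrightarrow> continuous_on (coord_sphere n) (\<lambda>x. h x i)"
    and odd: "\<And>x i. x \<in> coord_sphere n \<Longrightarrow> i < n \<Longrightarrow> h (\<lambda>i. - x i) i = - h x i"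
    and "finite A"
    and sel: "\<And>x. x \<in> coord_sphere n \<Longrightarrow> \<exists>a\<in>A. \<forall>i<n. h x i = (\<Sum>j\<le>n. a i j * x j)"
  shows "\<exists>x\<in>coord_sphere n. \<forall>i<n. h x i = 0"
proof (rule ccontr)
  assume no: "\<not> ?thesis"
  have nz: "\<exists>i<n. h x i \<noteq> 0" if x: "x \<in> coord_sphere n" for x using no x by blast
  define g where "g x i = (if i < n then h x i else 0)" for x i
  have gnz: "\<exists>i\<le>n. g x i \<noteq> 0" if "x \<in> coord_sphere n" for x
    using nz[OF that] by (auto simp: g_def intro: less_imp_le)
  have contg: "continuous_on (coord_sphere n) (\<lambda>x. g x i)" for i
    using cont by (cases "i < n") (auto simp: g_def)
  have "odd (Brouwer_degree2 n (normalize_map n g))"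
  proof (rule odd_Brouwer_degree_piecewise_linear[OF contg])
    show "finite ((\<lambda>a i j. if i < n then a i j else 0) ` A)" using \<open>finite A\<close> by simp
    show "\<exists>a\<in>(\<lambda>a i j. if i < n then a i j else 0) ` A. \<forall>i\<le>n. g x i = (\<Sum>j\<le>n. a i j * x j)"
      if "x \<in> coord_sphere n" for x
      using sel[OF that] by (force simp: g_def)
  qed (use odd gnz in \<open>auto simp: g_def\<close>)
  moreover have "Brouwer_degree2 n (normalize_map n g) = 0"
  proof (rule Brouwer_degree2_nonsurjective)
    show "continuous_map (nsphere n) (nsphere n) (normalize_map n g)"
      using gnz by (intro continuous_map_normalize_map contg) (auto simp: g_def)
    define e where "e i = (if i = n then 1 else 0 :: real)" for i
    have "e \<in> coord_sphere n"
    proof -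
      have "(\<Sum>i\<le>n. (e i)\<^sup>2) = (\<Sum>i\<le>n. if i = n then 1 else 0)"
        by (intro sum.cong) (auto simp: e_def)
      then show ?thesis by (simp add: coord_sphere_def e_def)
    qed
    moreover have "normalize_map n g x \<noteq> e" for x
    proof -
      have "normalize_map n g x n = 0" by (simp add: normalize_map_def g_def)
      moreover have "e n = 1" by (simp add: e_def)
      ultimately show ?thesis by force
    qed
    ultimately show "normalize_map n g ` topspace (nsphere n) \<noteq> topspace (nsphere n)"
      unfolding topspace_nsphere_eq by (metis imageE)
  qed
  ultimately show False by simp
qed

section \<open>The discrete ham sandwich theorem\<close>

text \<open>The ambient space is an infinite product, so compactness comes from Tychonoff's theorem
  for a cube that contains the sphere as a closed subset.\<close>

lemma compact_coord_sphere: "compact (coord_sphere n)"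
proof -
  have "compactin (powertop_real UNIV) (PiE UNIV (\<lambda>_ :: nat. {-1..1}))"
    by (intro compactin_PiE[THEN iffD2] disjI2 ballI) (simp only: compactin_euclidean_iff compact_Icc)
  then have "compact (PiE UNIV (\<lambda>_ :: nat. {-1..1 :: real}))"
    unfolding euclidean_product_topology compactin_euclidean_iff .
  moreover have "closed (coord_sphere n)"
  proof -
    have "coord_sphere n = {x. (\<Sum>i\<le>n. (x i)\<^sup>2) = 1} \<inter> (\<Inter>i\<in>{n<..}. {x. x i = 0})"
      by (auto simp: coord_sphere_def)
    moreover have "closed \<dots>"
      by (intro closed_Int closed_INT ballI closed_Collect_eq continuous_intros
          continuous_on_product_then_coordinatewise[OF continuous_on_id])
    ultimately show ?thesis by simp
  qed
  ultimately have "compact (PiE UNIV (\<lambda>_ :: nat. {-1..1 :: real}) \<inter> coord_sphere n)"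
    by (rule compact_Int_closed)
  moreover have "coord_sphere n \<subseteq> PiE UNIV (\<lambda>_. {-1..1})"
  proof
    fix x assume x: "x \<in> coord_sphere n"
    have "x i \<in> {-1..1}" for i
    proof (cases "i \<le> n")
      case True
      have "(x i)\<^sup>2 \<le> (\<Sum>i\<le>n. (x i)\<^sup>2)"
        using True by (intro member_le_sum) auto
      then have "\<bar>x i\<bar> \<le> 1"
        using x by (simp add: coord_sphere_def abs_square_le_1)
      then show ?thesis by auto
    qed (use x in \<open>auto simp: coord_sphere_def\<close>)
    then show "x \<in> PiE UNIV (\<lambda>_. {-1..1})" by auto
  qed
  ultimately show ?thesis by (simp add: Int_absorb1)
qed

text \<open>Elements with \<open>P\<close> contribute exactly \<open>c\<close> and all others at
  least \<open>- c\<close>, so a zero sum forces the former to be no more numerous than the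
  latter.\<close>

lemma majority_of_vanishing_sum:
  fixes f :: "'a \<Rightarrow> real"
  assumes "finite S" "sum f S = 0" "c > 0" "\<And>s. s \<in> S \<Longrightarrow> - c \<le> f s" "\<And>s. s \<in> S \<Longrightarrow> P s \<Longrightarrow> f s = c"
  shows "2 * card {s \<in> S. P s} \<le> card S"
proof -
  have "(\<Sum>s\<in>S. if P s then c else - c) \<le> sum f S"
    by (intro sum_mono) (use assms(4,5) in auto)
  moreover have "(\<Sum>s\<in>S. if P s then c else - c) = c * card {s \<in> S. P s} - c * card {s \<in> S. \<not> P s}"
    using assms(1) by (simp add: sum.If_cases Int_def)
  moreover have "card S = card {s \<in> S. P s} + card {s \<in> S. \<not> P s}"
    using assms(1) by (subst card_Un_disjoint[symmetric]) (auto intro!: arg_cong[where f = card])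
  ultimately have "c * (2 * real (card {s \<in> S. P s}) - card S) \<le> 0"
    using assms(2) by (simp add: algebra_simps)
  then have "2 * real (card {s \<in> S. P s}) \<le> card S"
    using \<open>c > 0\<close> by (simp add: mult_le_0_iff)
  then show ?thesis by linarith
qed

context
  fixes S :: "nat \<Rightarrow> 'p set" and \<phi> :: "'p \<Rightarrow> nat \<Rightarrow> real" and N :: nat
  assumes fin: "\<And>j. j < N \<Longrightarrow> finite (S j)"
begin

text \<open>\<open>\<phi>\<close> lifts points to \<open>N + 1\<close> coordinates, where the cuts
  are hyperplanes through the origin. With monomials as coordinates they become zero sets of
  polynomials.\<close>

definition functional :: "(nat \<Rightarrow> real) \<Rightarrow> 'p \<Rightarrow> real" where
  "functional v s = (\<Sum>i\<le>N. v i * \<phi> s i)"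

definition l1norm :: "(nat \<Rightarrow> real) \<Rightarrow> real" where
  "l1norm v = (\<Sum>i\<le>N. \<bar>v i\<bar>)"

text \<open>As \<open>\<epsilon>\<close> tends to 0 this becomes \<open>l1norm v\<close> times the sign of the functional. Clamping at the
  \<open>l1\<close> norm, rather than at 1, keeps the dependence on \<open>v\<close> linear on finitely many pieces.\<close>

definition clamped :: "real \<Rightarrow> (nat \<Rightarrow> real) \<Rightarrow> 'p \<Rightarrow> real" where
  "clamped \<epsilon> v s = max (- l1norm v) (min (l1norm v) (functional v s / \<epsilon>))"

lemma l1norm_nonneg: "l1norm v \<ge> 0"
  by (simp add: l1norm_def sum_nonneg)

lemma l1norm_pos: "v \<in> coord_sphere N \<Longrightarrow> l1norm v > 0"
proof (rule ccontr)
  assume v: "v \<in> coord_sphere N" and "\<not> l1norm v > 0"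
  then have "l1norm v = 0" using l1norm_nonneg[of v] by simp
  then have "\<forall>i\<le>N. v i = 0"
    unfolding l1norm_def by (subst (asm) sum_nonneg_eq_0_iff) auto
  then show False using v by (simp add: coord_sphere_def)
qed

text \<open>The \<open>N\<close> sums are odd and continuous in \<open>v\<close>. They are linear as
  long as the signs of \<open>v\<close> and the sets of points at the upper and lower clamp stay
  fixed, so Borsuk--Ulam applies.\<close>

lemma clamped_zero_exists:
  assumes "\<epsilon> > 0"
  shows "\<exists>v\<in>coord_sphere N. \<forall>j<N. (\<Sum>s\<in>S j. clamped \<epsilon> v s) = 0"
proof -
  define U where "U = (\<Union>j<N. S j)"
  have "finite U" using fin by (auto simp: U_def)
  \<comment> \<open>\<open>T\<close> will be the set of negative coordinates of \<open>v\<close>, so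
    that \<open>\<sigma> T\<close> are the coefficients of the norm; \<open>B\<close> and
    \<open>C\<close> will be the points at the upper and lower clamp.\<close>
  define \<sigma> where "\<sigma> T i = (if i \<in> T then - 1 else 1 :: real)" for T and i :: nat
  define row where "row T B C s i = (if s \<in> B then \<sigma> T i else if s \<in> C then - \<sigma> T i else \<phi> s i / \<epsilon>)"
    for T B C s i
  define M where "M = (\<lambda>(T, B, C) j i. \<Sum>s\<in>S j. row T B C s i)"
  show ?thesis
  proof (rule piecewise_linear_Borsuk_Ulam)
    show "continuous_on (coord_sphere N) (\<lambda>v. \<Sum>s\<in>S j. clamped \<epsilon> v s)" for j
      unfolding clamped_def functional_def l1norm_def using \<open>\<epsilon> > 0\<close>
      by (intro continuous_intros continuous_on_product_then_coordinatewise[OF continuous_on_id]) auto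
    show "(\<Sum>s\<in>S j. clamped \<epsilon> (\<lambda>i. - v i) s) = - (\<Sum>s\<in>S j. clamped \<epsilon> v s)" for v j
    proof -
      have "functional (\<lambda>i. - v i) s = - functional v s" "l1norm (\<lambda>i. - v i) = l1norm v" for s
        by (simp_all add: functional_def l1norm_def sum_negf)
      then have "clamped \<epsilon> (\<lambda>i. - v i) s = - clamped \<epsilon> v s" for s
        using l1norm_nonneg[of v] by (auto simp: clamped_def max_def min_def)
      then show ?thesis by (simp add: sum_negf)
    qed
    show "finite (M ` (Pow {..N} \<times> Pow U \<times> Pow U))"
      using \<open>finite U\<close> by simp
    show "\<exists>a\<in>M ` (Pow {..N} \<times> Pow U \<times> Pow U). \<forall>j<N. (\<Sum>s\<in>S j. clamped \<epsilon> v s) = (\<Sum>i\<le>N. a j i * v i)" for v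
    proof -
      define T where "T = {i. i \<le> N \<and> v i < 0}"
      define B where "B = {s \<in> U. functional v s / \<epsilon> \<ge> l1norm v}"
      define C where "C = {s \<in> U. functional v s / \<epsilon> \<le> - l1norm v}"
      have e1: "l1norm v = (\<Sum>i\<le>N. \<sigma> T i * v i)"
        unfolding l1norm_def by (intro sum.cong) (auto simp: \<sigma>_def T_def)
      have e2: "functional v s / \<epsilon> = (\<Sum>i\<le>N. \<phi> s i / \<epsilon> * v i)" for s
        by (simp add: functional_def sum_divide_distrib mult.commute)
      have "clamped \<epsilon> v s = (\<Sum>i\<le>N. row T B C s i * v i)" if "s \<in> U" for s
      proof -
        consider "s \<in> B" | "s \<notin> B" "s \<in> C" | "s \<notin> B" "s \<notin> C" by blast
        then show ?thesis
        proof cases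
          case 1
          then have "clamped \<epsilon> v s = l1norm v"
            using l1norm_nonneg[of v] by (simp add: clamped_def B_def)
          with 1 e1 show ?thesis by (simp add: row_def)
        next
          case 2
          then have "clamped \<epsilon> v s = - l1norm v"
            using l1norm_nonneg[of v] by (simp add: clamped_def C_def)
          with 2 e1 show ?thesis by (simp add: row_def sum_negf)
        next
          case 3
          then have "clamped \<epsilon> v s = functional v s / \<epsilon>"
            using that by (auto simp: clamped_def B_def C_def)
          with 3 e2[of s] show ?thesis by (simp add: row_def)
        qed
      qed
      then have "(\<Sum>s\<in>S j. clamped \<epsilon> v s) = (\<Sum>i\<le>N. M (T, B, C) j i * v i)" if "j < N" for j
        using that unfolding M_def sum_distrib_right prod.case
        by (subst sum.swap) (auto intro!: sum.cong simp: U_def)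
      moreover have "(T, B, C) \<in> Pow {..N} \<times> Pow U \<times> Pow U"
        by (auto simp: T_def B_def C_def)
      ultimately show ?thesis by (intro bexI[OF _ imageI[of "(T, B, C)"]]) simp_all
    qed
  qed
qed

text \<open>Compactness gives a limit \<open>l\<close> of zeros for scales
  \<open>\<epsilon> k\<close> tending to 0. A point off the limit hyperplane is eventually clamped,
  and a point on it contributes some value between the clamps, so the vanishing sum bounds the
  number of points on either side.\<close>

theorem discrete_ham_sandwich:
  "\<exists>v. (\<exists>i\<le>N. v i \<noteq> 0) \<and>
     (\<forall>j<N. 2 * card {s \<in> S j. 0 < (\<Sum>i\<le>N. v i * \<phi> s i)} \<le> card (S j) \<and>
            2 * card {s \<in> S j. (\<Sum>i\<le>N. v i * \<phi> s i) < 0} \<le> card (S j))"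
proof -
  define \<epsilon> :: "nat \<Rightarrow> real" where "\<epsilon> k = inverse (real (Suc k))" for k
  have eps: "\<epsilon> k > 0" for k by (simp add: \<epsilon>_def)
  obtain w where w: "\<And>k. w k \<in> coord_sphere N" "\<And>k j. j < N \<Longrightarrow> (\<Sum>s\<in>S j. clamped (\<epsilon> k) (w k) s) = 0"
    using clamped_zero_exists[OF eps] by metis
  obtain l r where l: "l \<in> coord_sphere N" and r: "strict_mono r" and lim: "(w \<circ> r) \<longlonglongrightarrow> l"
    using compact_coord_sphere[THEN compact_imp_seq_compact] w(1) unfolding seq_compact_def by metis
  have lim_i: "(\<lambda>k. w (r k) i) \<longlonglongrightarrow> l i" for i
  proof -
    have "continuous_on UNIV (\<lambda>x :: nat \<Rightarrow> real. x i)" by simp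
    from continuous_on_tendsto_compose[OF this lim] show ?thesis by (simp add: o_def)
  qed
  have lim_eps: "(\<lambda>k. \<epsilon> (r k)) \<longlonglongrightarrow> 0"
    using LIMSEQ_subseq_LIMSEQ[OF LIMSEQ_inverse_real_of_nat r] by (simp add: \<epsilon>_def o_def)
  have lim_fun: "(\<lambda>k. functional (w (r k)) s) \<longlonglongrightarrow> functional l s" for s
    unfolding functional_def by (intro tendsto_intros lim_i)
  have lim_norm: "(\<lambda>k. \<epsilon> (r k) * l1norm (w (r k))) \<longlonglongrightarrow> 0"
  proof -
    have "(\<lambda>k. \<epsilon> (r k) * l1norm (w (r k))) \<longlonglongrightarrow> 0 * l1norm l"
      unfolding l1norm_def by (intro tendsto_intros lim_i lim_eps)
    then show ?thesis by simp
  qed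
  \<comment> \<open>\<open>\<epsilon>\<close> times the norm tends to 0 while the functional has a
    positive limit, so the functional divided by \<open>\<epsilon>\<close> eventually exceeds the
    norm.\<close>
  have pos: "\<forall>\<^sub>F k in sequentially. functional l s > 0 \<longrightarrow> clamped (\<epsilon> (r k)) (w (r k)) s = l1norm (w (r k))" for s
  proof (cases "functional l s > 0")
    case True
    have "(\<lambda>k. functional (w (r k)) s - \<epsilon> (r k) * l1norm (w (r k))) \<longlonglongrightarrow> functional l s - 0"
      by (intro tendsto_intros lim_fun lim_norm)
    from order_tendstoD(1)[OF this, of 0] True
    have "\<forall>\<^sub>F k in sequentially. functional (w (r k)) s - \<epsilon> (r k) * l1norm (w (r k)) > 0"
      by simp
    then show ?thesis
    proof eventually_elim
      case (elim k)
      then have "functional (w (r k)) s / \<epsilon> (r k) \<ge> l1norm (w (r k))"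
        using eps[of "r k"] by (simp add: field_simps)
      then show ?case using l1norm_nonneg[of "w (r k)"] by (simp add: clamped_def)
    qed
  qed simp
  have neg: "\<forall>\<^sub>F k in sequentially. functional l s < 0 \<longrightarrow> clamped (\<epsilon> (r k)) (w (r k)) s = - l1norm (w (r k))" for s
  proof (cases "functional l s < 0")
    case True
    have "(\<lambda>k. functional (w (r k)) s + \<epsilon> (r k) * l1norm (w (r k))) \<longlonglongrightarrow> functional l s + 0"
      by (intro tendsto_intros lim_fun lim_norm)
    from order_tendstoD(2)[OF this, of 0] True
    have "\<forall>\<^sub>F k in sequentially. functional (w (r k)) s + \<epsilon> (r k) * l1norm (w (r k)) < 0"
      by simp
    then show ?thesis
    proof eventually_elim
      case (elim k)
      then have "functional (w (r k)) s / \<epsilon> (r k) \<le> - l1norm (w (r k))"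
        using eps[of "r k"] by (simp add: field_simps)
      then show ?case using l1norm_nonneg[of "w (r k)"] by (simp add: clamped_def)
    qed
  qed simp
  have "2 * card {s \<in> S j. 0 < functional l s} \<le> card (S j) \<and>
        2 * card {s \<in> S j. functional l s < 0} \<le> card (S j)" if j: "j < N" for j
  proof -
    \<comment> \<open>As \<open>S j\<close> is finite, one index \<open>k\<close> serves all its
      points.\<close>
    have "\<forall>\<^sub>F k in sequentially. \<forall>s\<in>S j.
        (functional l s > 0 \<longrightarrow> clamped (\<epsilon> (r k)) (w (r k)) s = l1norm (w (r k))) \<and>
        (functional l s < 0 \<longrightarrow> clamped (\<epsilon> (r k)) (w (r k)) s = - l1norm (w (r k)))"
      using fin[OF j] by (intro eventually_ball_finite ballI eventually_conj pos neg)
    then obtain k where k: "\<forall>s\<in>S j.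
        (functional l s > 0 \<longrightarrow> clamped (\<epsilon> (r k)) (w (r k)) s = l1norm (w (r k))) \<and>
        (functional l s < 0 \<longrightarrow> clamped (\<epsilon> (r k)) (w (r k)) s = - l1norm (w (r k)))"
      using eventually_happens by fastforce
    let ?v = "w (r k)"
    have nn: "l1norm ?v > 0" using l1norm_pos w(1) by simp
    have b: "- l1norm ?v \<le> clamped (\<epsilon> (r k)) ?v s" "clamped (\<epsilon> (r k)) ?v s \<le> l1norm ?v" for s
      using nn by (auto simp: clamped_def)
    have "2 * card {s \<in> S j. 0 < functional l s} \<le> card (S j)"
      by (rule majority_of_vanishing_sum[OF fin[OF j] w(2)[OF j, of "r k"] nn]) (use b k in auto)
    moreover have "2 * card {s \<in> S j. functional l s < 0} \<le> card (S j)"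
      by (rule majority_of_vanishing_sum[OF fin[OF j], of "\<lambda>s. - clamped (\<epsilon> (r k)) ?v s", OF _ nn])
        (use b k w(2)[OF j, of "r k"] in \<open>auto simp: sum_negf\<close>)
    ultimately show ?thesis by simp
  qed
  moreover have "\<exists>i\<le>N. l i \<noteq> 0"
  proof (rule ccontr)
    assume "\<not> ?thesis"
    then show False using l by (simp add: coord_sphere_def)
  qed
  ultimately show ?thesis unfolding functional_def by blast
qed

end

section \<open>Evaluation of polynomials\<close>

abbreviation monomial_at :: "('d::finite \<Rightarrow>\<^sub>0 nat) \<Rightarrow> real ^ 'd \<Rightarrow> real" where
  "monomial_at m x \<equiv> \<Prod>i\<in>UNIV. (x $ i) ^ Poly_Mapping.lookup m i"

lemma eval_mpoly_superset:
  assumes "finite A" "Poly_Mapping.keys f \<subseteq> A"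
  shows "eval_mpoly f x = (\<Sum>m\<in>A. Poly_Mapping.lookup f m * monomial_at m x)"
  unfolding eval_mpoly_def using assms
  by (intro sum.mono_neutral_left) (auto simp: in_keys_iff)

lemma eval_mpoly_0 [simp]: "eval_mpoly 0 x = 0"
  by (simp add: eval_mpoly_def)

lemma eval_mpoly_add: "eval_mpoly (f + g) x = eval_mpoly f x + eval_mpoly g x"
proof -
  let ?A = "Poly_Mapping.keys f \<union> Poly_Mapping.keys g"
  have "eval_mpoly h x = (\<Sum>m\<in>?A. Poly_Mapping.lookup h m * monomial_at m x)" if "h \<in> {f, g, f + g}" for h
    using that Poly_Mapping.keys_add[of f g] by (intro eval_mpoly_superset) auto
  then show ?thesis by (simp add: lookup_add algebra_simps sum.distrib)
qed

lemma eval_mpoly_sum: "eval_mpoly (sum f A) x = (\<Sum>i\<in>A. eval_mpoly (f i) x)"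
  by (induction A rule: infinite_finite_induct) (auto simp: eval_mpoly_add)

lemma eval_mpoly_single: "eval_mpoly (Poly_Mapping.single m c) x = c * monomial_at m x"
  by (subst eval_mpoly_superset[of "{m}"]) auto

lemma mpoly_eq_sum_single:
  "(f :: ('b \<Rightarrow>\<^sub>0 'c::comm_monoid_add)) = (\<Sum>m\<in>Poly_Mapping.keys f. Poly_Mapping.single m (Poly_Mapping.lookup f m))"
proof (rule poly_mapping_eqI)
  fix k
  have "(\<Sum>m\<in>Poly_Mapping.keys f. Poly_Mapping.lookup (Poly_Mapping.single m (Poly_Mapping.lookup f m)) k)
      = (\<Sum>m\<in>Poly_Mapping.keys f. if m = k then Poly_Mapping.lookup f m else 0)"
    by (intro sum.cong) (auto simp: lookup_single)
  then show "Poly_Mapping.lookup f k = Poly_Mapping.lookup (\<Sum>m\<in>Poly_Mapping.keys f. Poly_Mapping.single m (Poly_Mapping.lookup f m)) k"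
    by (simp add: lookup_sum in_keys_iff)
qed

lemma eval_mpoly_mult: "eval_mpoly (f * g) x = eval_mpoly f x * eval_mpoly g x"
proof -
  have mono: "monomial_at (m + m') x = monomial_at m x * monomial_at m' x" for m m'
    by (simp add: lookup_add power_add prod.distrib)
  have "f * g = (\<Sum>m\<in>Poly_Mapping.keys f. \<Sum>m'\<in>Poly_Mapping.keys g.
      Poly_Mapping.single (m + m') (Poly_Mapping.lookup f m * Poly_Mapping.lookup g m'))"
    by (subst mpoly_eq_sum_single[of f], subst mpoly_eq_sum_single[of g])
      (simp add: sum_product mult_single)
  then show ?thesis
    unfolding eval_mpoly_def[of f] eval_mpoly_def[of g]
    by (simp add: eval_mpoly_sum eval_mpoly_single mono sum_product mult_ac)
qed

lemma total_degree_le_iff: "total_degree f \<le> D \<longleftrightarrow> (\<forall>m\<in>Poly_Mapping.keys f. monom_degree m \<le> D)"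
  by (simp add: total_degree_def)

lemma total_degree_mult: "total_degree (f * g) \<le> total_degree f + total_degree g"
  unfolding total_degree_le_iff
proof
  fix m assume "m \<in> Poly_Mapping.keys (f * g)"
  then obtain a b where "m = a + b" "a \<in> Poly_Mapping.keys f" "b \<in> Poly_Mapping.keys g"
    using keys_mult[of f g] by auto
  moreover have "monom_degree (a + b) = monom_degree a + monom_degree b"
    by (simp add: monom_degree_def lookup_add sum.distrib)
  ultimately show "monom_degree m \<le> total_degree f + total_degree g"
    using total_degree_le_iff[of f "total_degree f"] total_degree_le_iff[of g "total_degree g"]
    by (auto intro: add_mono)
qed

section \<open>Kronecker substitution and products of non-zero polynomials\<close>

text \<open>Comparison modulo \<open>M\<close> gives the lowest digit, induction the others. This
  recovers a monomial from its single exponent after the substitution below.\<close>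

lemma base_digits_unique:
  fixes a b :: "nat \<Rightarrow> nat"
  assumes "\<forall>k<n. a k < M" "\<forall>k<n. b k < M" "(\<Sum>k<n. a k * M ^ k) = (\<Sum>k<n. b k * M ^ k)"
  shows "\<forall>k<n. a k = b k"
  using assms
proof (induction n arbitrary: a b)
  case (Suc n)
  have shift: "(\<Sum>k<Suc n. c k * M ^ k) = c 0 + M * (\<Sum>k<n. c (Suc k) * M ^ k)" for c :: "nat \<Rightarrow> nat"
    by (subst sum.lessThan_Suc_shift) (simp add: sum_distrib_left mult_ac)
  have lt: "a 0 < M" "b 0 < M" using Suc.prems by auto
  have eq: "a 0 + M * (\<Sum>k<n. a (Suc k) * M ^ k) = b 0 + M * (\<Sum>k<n. b (Suc k) * M ^ k)"
    using Suc.prems(3) by (simp only: shift)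
  have 0: "a 0 = b 0"
    using arg_cong[OF eq, of "\<lambda>z. z mod M"] lt by simp
  with eq lt have "(\<Sum>k<n. a (Suc k) * M ^ k) = (\<Sum>k<n. b (Suc k) * M ^ k)" by simp
  with Suc.IH[of "\<lambda>k. a (Suc k)" "\<lambda>k. b (Suc k)"] Suc.prems(1,2)
  have "\<forall>k<n. a (Suc k) = b (Suc k)" by simp
  with 0 show ?case by (metis less_Suc_eq_0_disj)
qed simp

text \<open>Kronecker substitution: along the curve \<open>t \<mapsto> (t\<^bsup>M^0\<^esup>, t\<^bsup>M^1\<^esup>, \<dots>)\<close> distinct monomials with
  exponents below \<open>M\<close> become distinct powers of \<open>t\<close>.\<close>

lemma eval_mpoly_curve_nonzero:
  fixes f :: "'d::finite mpolynomial"
  assumes "f \<noteq> 0" and e: "bij_betw e (UNIV :: 'd set) {..<CARD('d)}"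
    and M: "\<And>m i. m \<in> Poly_Mapping.keys f \<Longrightarrow> Poly_Mapping.lookup m i < M"
  shows "\<exists>p. p \<noteq> 0 \<and> (\<forall>t. eval_mpoly f (\<chi> i. t ^ (M ^ e i)) = poly p t)"
proof -
  define w where "w m = (\<Sum>i\<in>UNIV. Poly_Mapping.lookup m i * M ^ e i)" for m :: "'d \<Rightarrow>\<^sub>0 nat"
  define p where "p = (\<Sum>m\<in>Poly_Mapping.keys f. Polynomial.monom (Poly_Mapping.lookup f m) (w m))"
  define e' where "e' = inv_into UNIV e"
  have e'e: "e' (e i) = i" for i
    using e by (simp add: e'_def bij_betw_def)
  have w_digits: "w m = (\<Sum>k<CARD('d). Poly_Mapping.lookup m (e' k) * M ^ k)" for m
    unfolding w_def by (rule sum.reindex_bij_betw[OF e, of "\<lambda>k. Poly_Mapping.lookup m (e' k) * M ^ k", symmetric, unfolded e'e, symmetric])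
  have inj: "m = m'" if "m \<in> Poly_Mapping.keys f" "m' \<in> Poly_Mapping.keys f" "w m = w m'" for m m'
  proof -
    have *: "\<forall>k<CARD('d). Poly_Mapping.lookup m (e' k) = Poly_Mapping.lookup m' (e' k)"
      using that M by (intro base_digits_unique[of _ _ M]) (auto simp: w_digits)
    have "Poly_Mapping.lookup m i = Poly_Mapping.lookup m' i" for i
    proof -
      have "e i < CARD('d)" using e by (auto simp: bij_betw_def)
      with * have "Poly_Mapping.lookup m (e' (e i)) = Poly_Mapping.lookup m' (e' (e i))" by blast
      then show ?thesis by (simp add: e'e)
    qed
    then show ?thesis by (intro poly_mapping_eqI)
  qed
  obtain m where m: "m \<in> Poly_Mapping.keys f" using \<open>f \<noteq> 0\<close> keys_eq_empty by blast
  \<comment> \<open>Distinct monomials of \<open>f\<close> have distinct weights \<open>w\<close>,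
    so nothing cancels in this coefficient.\<close>
  have "Polynomial.coeff p (w m) = (\<Sum>m'\<in>Poly_Mapping.keys f. if m' = m then Poly_Mapping.lookup f m' else 0)"
    unfolding p_def coeff_sum using inj m by (intro sum.cong) auto
  also have "\<dots> = Poly_Mapping.lookup f m" using m by simp
  finally have "p \<noteq> 0" using m by (auto simp: in_keys_iff)
  moreover have "eval_mpoly f (\<chi> i. t ^ (M ^ e i)) = poly p t" for t
  proof -
    have "monomial_at m (\<chi> i. t ^ (M ^ e i)) = t ^ w m" for m
      by (simp add: w_def power_sum mult.commute flip: power_mult)
    then show ?thesis by (simp add: eval_mpoly_def p_def poly_sum poly_monom)
  qed
  ultimately show ?thesis by blast
qed

text \<open>Along one common curve, with \<open>M\<close> above all exponents, both factors become
  non-zero univariate polynomials, and their product has a non-root.\<close>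

lemma mpoly_mult_nonzero:
  fixes f g :: "'d::finite mpolynomial"
  assumes "f \<noteq> 0" "g \<noteq> 0"
  shows "f * g \<noteq> 0"
proof -
  obtain e where e: "bij_betw e (UNIV :: 'd set) {..<CARD('d)}"
    using ex_bij_betw_finite_nat[of "UNIV :: 'd set"] by (auto simp: atLeast0LessThan)
  define E where "E = (\<lambda>(m, i). Poly_Mapping.lookup m i) ` ((Poly_Mapping.keys f \<union> Poly_Mapping.keys g) \<times> (UNIV :: 'd set))"
  define M where "M = Suc (Max E)"
  have "Poly_Mapping.lookup m i < M" if "m \<in> Poly_Mapping.keys f \<union> Poly_Mapping.keys g" for m i
  proof -
    have "Poly_Mapping.lookup m i \<in> E" using that by (auto simp: E_def)
    then show ?thesis unfolding M_def by (intro le_imp_less_Suc Max_ge) (auto simp: E_def)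
  qed
  then obtain p q where p: "p \<noteq> 0" "\<And>t. eval_mpoly f (\<chi> i. t ^ (M ^ e i)) = poly p t"
    and q: "q \<noteq> 0" "\<And>t. eval_mpoly g (\<chi> i. t ^ (M ^ e i)) = poly q t"
    using eval_mpoly_curve_nonzero[OF assms(1) e, of M] eval_mpoly_curve_nonzero[OF assms(2) e, of M] by auto
  have "p * q \<noteq> 0" using p q by simp
  then obtain t where "poly (p * q) t \<noteq> 0" using poly_all_0_iff_0 by blast
  then have "eval_mpoly (f * g) (\<chi> i. t ^ (M ^ e i)) \<noteq> 0"
    by (simp add: eval_mpoly_mult p q)
  then show ?thesis by auto
qed

section \<open>Restriction to lines and segments\<close>

text \<open>Each monomial becomes a product of as many polynomials of degree at most 1 as its
  degree. This will bound the zeros on a line outside the zero set.\<close>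

lemma eval_mpoly_line:
  fixes f :: "'d::finite mpolynomial"
  obtains p where "Polynomial.degree p \<le> total_degree f" "\<And>t. poly p t = eval_mpoly f (a + t *\<^sub>R b)"
proof
  define p where "p = (\<Sum>m\<in>Poly_Mapping.keys f. Polynomial.smult (Poly_Mapping.lookup f m)
      (\<Prod>i\<in>UNIV. [:a $ i, b $ i:] ^ Poly_Mapping.lookup m i))"
  show "poly p t = eval_mpoly f (a + t *\<^sub>R b)" for t
    by (simp add: p_def eval_mpoly_def poly_sum poly_prod)
  show "Polynomial.degree p \<le> total_degree f"
    unfolding p_def
  proof (rule degree_sum_le)
    fix m assume m: "m \<in> Poly_Mapping.keys f"
    have "Polynomial.degree (Polynomial.smult (Poly_Mapping.lookup f m) (\<Prod>i\<in>UNIV. [:a $ i, b $ i:] ^ Poly_Mapping.lookup m i))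
        \<le> Polynomial.degree (\<Prod>i\<in>UNIV. [:a $ i, b $ i:] ^ Poly_Mapping.lookup m i)"
      by (rule degree_smult_le)
    also have "\<dots> \<le> (\<Sum>i\<in>UNIV. Polynomial.degree ([:a $ i, b $ i:] ^ Poly_Mapping.lookup m i))"
      by (rule degree_prod_sum_le[unfolded o_def]) simp
    also have "\<dots> \<le> (\<Sum>i\<in>UNIV. Poly_Mapping.lookup m i)"
    proof (rule sum_mono)
      fix i
      have "Polynomial.degree ([:a $ i, b $ i:] ^ Poly_Mapping.lookup m i)
          \<le> Polynomial.degree [:a $ i, b $ i:] * Poly_Mapping.lookup m i"
        by (rule degree_power_le)
      also have "\<dots> \<le> 1 * Poly_Mapping.lookup m i"
        by (intro mult_right_mono) auto
      finally show "Polynomial.degree ([:a $ i, b $ i:] ^ Poly_Mapping.lookup m i) \<le> Poly_Mapping.lookup m i"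
        by simp
    qed
    also have "\<dots> \<le> total_degree f"
      using m total_degree_le_iff[of f "total_degree f"] by (simp add: monom_degree_def)
    finally show "Polynomial.degree (Polynomial.smult (Poly_Mapping.lookup f m) (\<Prod>i\<in>UNIV. [:a $ i, b $ i:] ^ Poly_Mapping.lookup m i))
        \<le> total_degree f" .
  qed simp
qed

lemma continuous_on_eval_mpoly: "continuous_on S (eval_mpoly f)"
  unfolding eval_mpoly_def by (intro continuous_intros)

text \<open>Intermediate value theorem: a change of sign would force a zero on the segment.\<close>

lemma eval_mpoly_same_sign:
  assumes "\<forall>z\<in>closed_segment x y. eval_mpoly f z \<noteq> 0"
  shows "0 < eval_mpoly f x \<longleftrightarrow> 0 < eval_mpoly f y"
proof -
  have "connected (eval_mpoly f ` closed_segment x y)"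
    by (intro connected_continuous_image continuous_on_eval_mpoly connected_segment)
  then have "0 \<in> eval_mpoly f ` closed_segment x y"
    if "eval_mpoly f x \<le> 0 \<and> 0 \<le> eval_mpoly f y \<or> eval_mpoly f y \<le> 0 \<and> 0 \<le> eval_mpoly f x"
    using that connectedD_interval[of "eval_mpoly f ` closed_segment x y"] by (metis ends_in_segment imageI)
  with assms show ?thesis by (metis imageE linorder_not_le order_less_imp_le)
qed

section \<open>Polynomial partitioning\<close>

text \<open>Bounding each exponent rather than the total degree makes the count an exact power, at
  the price of a factor \<open>CARD('d)\<close> in the degree.\<close>

lemma card_bounded_monomials:
  "\<exists>B :: ('d::finite \<Rightarrow>\<^sub>0 nat) set. finite B \<and> card B = (e + 1) ^ CARD('d) \<and> (\<forall>m\<in>B. \<forall>i. Poly_Mapping.lookup m i \<le> e)"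
proof -
  let ?G = "PiE (UNIV :: 'd set) (\<lambda>_. {..e})"
  have "inj_on Poly_Mapping.Abs_poly_mapping ?G"
    by (rule inj_onI) (auto dest!: arg_cong[where f = Poly_Mapping.lookup])
  then have "card (Poly_Mapping.Abs_poly_mapping ` ?G) = (e + 1) ^ CARD('d)"
    by (simp add: card_image card_PiE)
  then show ?thesis
    by (intro exI[of _ "Poly_Mapping.Abs_poly_mapping ` ?G"]) (auto simp: finite_PiE)
qed

text \<open>The lift uses \<open>N + 1\<close> of the \<open>(e + 1) ^ CARD('d)\<close> monomials
  with exponents at most \<open>e\<close>; a halving hyperplane then is a polynomial with these
  monomials.\<close>

theorem polynomial_ham_sandwich:
  fixes S :: "nat \<Rightarrow> (real ^ 'd::finite) set"
  assumes fin: "\<And>j. j < N \<Longrightarrow> finite (S j)" and N: "N < (e + 1) ^ CARD('d)"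
  obtains f :: "'d mpolynomial" where "f \<noteq> 0" "total_degree f \<le> CARD('d) * e"
    "\<And>j. j < N \<Longrightarrow> 2 * card {x \<in> S j. 0 < eval_mpoly f x} \<le> card (S j)"
    "\<And>j. j < N \<Longrightarrow> 2 * card {x \<in> S j. eval_mpoly f x < 0} \<le> card (S j)"
proof -
  obtain B :: "('d \<Rightarrow>\<^sub>0 nat) set" where B: "finite B" "card B = (e + 1) ^ CARD('d)"
    "\<And>m i. m \<in> B \<Longrightarrow> Poly_Mapping.lookup m i \<le> e"
    using card_bounded_monomials by metis
  have "card {..N} \<le> card B" using N B(2) by simp
  then obtain \<iota> where \<iota>: "\<iota> ` {..N} \<subseteq> B" "inj_on \<iota> {..N}"
    using card_le_inj[OF finite_atMost B(1)] by blast
  obtain v where v: "\<exists>i\<le>N. v i \<noteq> 0"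
    "\<And>j. j < N \<Longrightarrow> 2 * card {x \<in> S j. 0 < (\<Sum>i\<le>N. v i * monomial_at (\<iota> i) x)} \<le> card (S j)"
    "\<And>j. j < N \<Longrightarrow> 2 * card {x \<in> S j. (\<Sum>i\<le>N. v i * monomial_at (\<iota> i) x) < 0} \<le> card (S j)"
    using discrete_ham_sandwich[of N S "\<lambda>x i. monomial_at (\<iota> i) x", OF fin] by blast
  define f where "f = (\<Sum>i\<le>N. Poly_Mapping.single (\<iota> i) (v i))"
  have eval: "eval_mpoly f x = (\<Sum>i\<le>N. v i * monomial_at (\<iota> i) x)" for x
    by (simp add: f_def eval_mpoly_sum eval_mpoly_single)
  obtain i where i: "i \<le> N" "v i \<noteq> 0" using v by auto
  \<comment> \<open>Since \<open>\<iota>\<close> is injective, the coefficient \<open>v i\<close>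
    survives and \<open>f\<close> is not zero.\<close>
  have "Poly_Mapping.lookup f (\<iota> i) = (\<Sum>k\<le>N. if k = i then v k else 0)"
    unfolding f_def lookup_sum using \<iota>(2) i
    by (intro sum.cong) (auto simp: lookup_single inj_on_def when_def)
  then have f0: "f \<noteq> 0" using i by auto
  have deg: "total_degree f \<le> CARD('d) * e"
    unfolding total_degree_le_iff
  proof
    fix m assume "m \<in> Poly_Mapping.keys f"
    then have "m \<in> (\<Union>k\<in>{..N}. Poly_Mapping.keys (Poly_Mapping.single (\<iota> k) (v k)))"
      unfolding f_def using Poly_Mapping.keys_sum by (rule subsetD[rotated])
    then obtain k where "k \<le> N" "m \<in> Poly_Mapping.keys (Poly_Mapping.single (\<iota> k) (v k))" by blast
    then have "m = \<iota> k" by (metis empty_iff keys_single singletonD)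
    then have "m \<in> B" using \<iota>(1) \<open>k \<le> N\<close> by blast
    then have "monom_degree m \<le> (\<Sum>i\<in>(UNIV :: 'd set). e)"
      unfolding monom_degree_def by (intro sum_mono B(3))
    then show "monom_degree m \<le> CARD('d) * e" by simp
  qed
  show thesis
    by (rule that[OF f0 deg]) (use v(2,3) in \<open>simp_all only: eval\<close>)
qed

text \<open>The last clause says that points in the same component of the complement of the zero set
  share their cell; it is only needed along segments.\<close>

definition has_partition :: "(real ^ 'd::finite) set \<Rightarrow> nat \<Rightarrow> nat \<Rightarrow> bool" where
  "has_partition P J D \<longleftrightarrow> (\<exists>(f :: 'd mpolynomial) C. f \<noteq> 0 \<and> total_degree f \<le> D \<and>
     (\<forall>j < 2 ^ J :: nat. C j \<subseteq> P \<and> card (C j) * 2 ^ J \<le> card P) \<and>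
     (\<forall>x\<in>P. eval_mpoly f x \<noteq> 0 \<longrightarrow> (\<exists>j < 2 ^ J. x \<in> C j)) \<and>
     (\<forall>x\<in>P. \<forall>y\<in>P. (\<forall>z\<in>closed_segment x y. eval_mpoly f z \<noteq> 0) \<longrightarrow>
        (\<forall>j < 2 ^ J. x \<in> C j \<longleftrightarrow> y \<in> C j)))"

lemma has_partition_0: "has_partition P 0 0"
proof -
  have "total_degree (1 :: 'd::finite mpolynomial) \<le> 0"
    unfolding total_degree_le_iff by (simp add: monom_degree_def)
  then show ?thesis
    unfolding has_partition_def
    by (intro exI[of _ 1] exI[of _ "\<lambda>_. P"]) auto
qed

text \<open>One polynomial \<open>g\<close> bisects all \<open>2 ^ J\<close> cells at once and is
  multiplied to \<open>f\<close>. Points on the zero set of \<open>g\<close> drop out of the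
  cells.\<close>

lemma has_partition_Suc:
  fixes P :: "(real ^ 'd::finite) set"
  assumes "finite P" "has_partition P J D" "2 ^ J < (e + 1) ^ CARD('d)"
  shows "has_partition P (Suc J) (D + CARD('d) * e)"
proof -
  obtain f :: "'d mpolynomial" and C where f: "f \<noteq> 0" "total_degree f \<le> D"
    and C_all: "\<forall>j < 2 ^ J :: nat. C j \<subseteq> P \<and> card (C j) * 2 ^ J \<le> card P"
    and cover: "\<forall>x\<in>P. eval_mpoly f x \<noteq> 0 \<longrightarrow> (\<exists>j < 2 ^ J. x \<in> C j)"
    and seg_all: "\<forall>x\<in>P. \<forall>y\<in>P. (\<forall>z\<in>closed_segment x y. eval_mpoly f z \<noteq> 0) \<longrightarrow>
        (\<forall>j < 2 ^ J. x \<in> C j \<longleftrightarrow> y \<in> C j)"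
    using assms(2) unfolding has_partition_def by (elim exE conjE) (rule that)
  have C: "C j \<subseteq> P" "card (C j) * 2 ^ J \<le> card P" if "j < 2 ^ J" for j
    using C_all that by auto
  have seg: "x \<in> C j \<longleftrightarrow> y \<in> C j"
    if "x \<in> P" "y \<in> P" "\<forall>z\<in>closed_segment x y. eval_mpoly f z \<noteq> 0" "j < 2 ^ J" for x y j
    using seg_all[rule_format, OF that(1,2) _ that(4)] that(3) by simp
  have finC: "finite (C j)" if "j < 2 ^ J" for j using C(1)[OF that] assms(1) by (rule finite_subset)
  obtain g :: "'d mpolynomial" where g: "g \<noteq> 0" "total_degree g \<le> CARD('d) * e"
    "\<And>j. j < 2 ^ J \<Longrightarrow> 2 * card {x \<in> C j. 0 < eval_mpoly g x} \<le> card (C j)"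
    "\<And>j. j < 2 ^ J \<Longrightarrow> 2 * card {x \<in> C j. eval_mpoly g x < 0} \<le> card (C j)"
    by (rule polynomial_ham_sandwich[of "2 ^ J" C, OF finC assms(3)]) (assumption, rule that)
  \<comment> \<open>Cell \<open>i\<close> has the children \<open>2 * i\<close>, where
    \<open>g\<close> is positive, and \<open>2 * i + 1\<close>, where it is negative.\<close>
  define C' where "C' j = (if even j then {x \<in> C (j div 2). 0 < eval_mpoly g x} else {x \<in> C (j div 2). eval_mpoly g x < 0})" for j
  have half: "j div 2 < 2 ^ J" if "j < 2 ^ Suc J" for j :: nat using that by auto
  have fg: "f * g \<noteq> 0" using f g by (intro mpoly_mult_nonzero)
  have deg: "total_degree (f * g) \<le> D + CARD('d) * e"
    using total_degree_mult[of f g] f(2) g(2) by simp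
  have sub: "C' j \<subseteq> P" if "j < 2 ^ Suc J" for j
    using C(1)[OF half[OF that]] by (auto simp: C'_def)
  have size: "card (C' j) * 2 ^ Suc J \<le> card P" if "j < 2 ^ Suc J" for j
  proof -
    have "2 * card (C' j) \<le> card (C (j div 2))"
      using g(3,4)[OF half[OF that]] by (simp add: C'_def)
    then have "2 * card (C' j) * 2 ^ J \<le> card (C (j div 2)) * 2 ^ J" by simp
    also have "\<dots> \<le> card P" by (rule C(2)[OF half[OF that]])
    finally show ?thesis by (simp add: mult_ac)
  qed
  have cov: "\<exists>j < 2 ^ Suc J. x \<in> C' j" if x: "x \<in> P" "eval_mpoly (f * g) x \<noteq> 0" for x
  proof -
    have "eval_mpoly f x \<noteq> 0" "eval_mpoly g x \<noteq> 0" using x(2) by (auto simp: eval_mpoly_mult)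
    then obtain j where j: "j < 2 ^ J" "x \<in> C j" using cover x(1) by blast
    show ?thesis
    proof (cases "0 < eval_mpoly g x")
      case True
      with j show ?thesis by (intro exI[of _ "2 * j"]) (simp add: C'_def)
    next
      case False
      with j \<open>eval_mpoly g x \<noteq> 0\<close> show ?thesis by (intro exI[of _ "2 * j + 1"]) (simp add: C'_def)
    qed
  qed
  have same: "x \<in> C' j \<longleftrightarrow> y \<in> C' j"
    if xy: "x \<in> P" "y \<in> P" and nz: "\<forall>z\<in>closed_segment x y. eval_mpoly (f * g) z \<noteq> 0" and j: "j < 2 ^ Suc J" for x y j
  proof -
    have nzf: "\<forall>z\<in>closed_segment x y. eval_mpoly f z \<noteq> 0" and nzg: "\<forall>z\<in>closed_segment x y. eval_mpoly g z \<noteq> 0"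
      using nz by (auto simp: eval_mpoly_mult)
    have "x \<in> C (j div 2) \<longleftrightarrow> y \<in> C (j div 2)" by (rule seg[OF xy nzf half[OF j]])
    moreover have "eval_mpoly g x \<noteq> 0" "eval_mpoly g y \<noteq> 0" using nzg by auto
    ultimately show ?thesis
      using eval_mpoly_same_sign[OF nzg] by (auto simp: C'_def)
  qed
  show ?thesis
    unfolding has_partition_def
    by (intro exI[of _ "f * g"] exI[of _ C'] conjI ballI allI impI fg deg sub size cov same) (assumption | erule (1) bspec)+
qed

lemma has_partition_mono: "has_partition P J D \<Longrightarrow> D \<le> D' \<Longrightarrow> has_partition P J D'"
  unfolding has_partition_def
  by (elim exE conjE) (intro exI conjI, assumption, erule (1) order_trans, assumption+)

text \<open>Passing from \<open>k\<close> to \<open>k + 1\<close> takes \<open>d = CARD('d)\<close>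
  bisections with the same \<open>e = 2 ^ (k + 1) - 1\<close>. Each adds at most
  \<open>d * 2 ^ (k + 1)\<close> to the degree, together at most \<open>2 * d^2 * 2 ^ k\<close>, so
  the degree bound doubles.\<close>

theorem polynomial_partitioning:
  fixes P :: "(real ^ 'd::finite) set"
  assumes "finite P"
  shows "has_partition P (CARD('d) * k) (2 * CARD('d)\<^sup>2 * 2 ^ k)"
proof (induction k)
  case 0
  show ?case using has_partition_mono[OF has_partition_0] by simp
next
  case (Suc k)
  let ?d = "CARD('d)"
  obtain e :: nat where e: "e + 1 = 2 ^ Suc k"
    using that[of "2 ^ Suc k - 1"] by simp
  have "has_partition P (?d * k + i) (2 * ?d\<^sup>2 * 2 ^ k + i * (?d * e))" if "i \<le> ?d" for i
    using that
  proof (induction i)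
    case (Suc i)
    \<comment> \<open>Since \<open>i < ?d\<close>, there are still enough monomials to bisect all
      present cells.\<close>
    have "(2 :: nat) ^ (?d * k + i) < 2 ^ (Suc k * ?d)"
      using Suc.prems by (intro power_strict_increasing) (simp_all add: algebra_simps)
    then have "2 ^ (?d * k + i) < (e + 1) ^ ?d" by (simp only: e power_mult)
    from has_partition_Suc[OF assms Suc.IH this] Suc.prems show ?case by (simp add: algebra_simps)
  qed (use Suc.IH in simp)
  from this[of ?d] have "has_partition P (?d * Suc k) (2 * ?d\<^sup>2 * 2 ^ k + ?d * (?d * e))"
    by (simp add: algebra_simps)
  moreover have "?d * (?d * e) \<le> ?d\<^sup>2 * 2 ^ Suc k"
    using e by (simp add: power2_eq_square mult.assoc)
  ultimately show ?case
    by (elim has_partition_mono) (simp add: algebra_simps)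
qed

section \<open>Counting rich lines\<close>

lemma line_eq_affine_hull:
  assumes "is_line l" "x \<in> l" "y \<in> l" "x \<noteq> y"
  shows "l = affine hull {x, y}"
proof (rule ccontr)
  assume ne: "l \<noteq> affine hull {x, y}"
  have l: "affine hull l = l" "aff_dim l = 1"
    using assms(1) by (auto simp: is_line_def affine_hull_eq)
  have "affine hull {x, y} \<subseteq> l"
    using assms by (intro hull_minimal) (auto simp: is_line_def)
  with ne have "affine hull {x, y} \<subset> affine hull l" unfolding l(1) by blast
  then have "aff_dim {x, y} < aff_dim l" by (rule aff_dim_psubset)
  with l assms(4) show False by (simp add: aff_dim_2)
qed

text \<open>Double counting: two points determine their line, so different lines use disjoint sets
  of pairs. These sets are non-empty by \<open>m \<ge> 1\<close>, so \<open>L\<close> injects into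
  the subsets of \<open>W\<close> and is finite.\<close>

lemma lines_count_by_pairs:
  fixes L :: "(real ^ 'd) set set"
  assumes lines: "\<And>l. l \<in> L \<Longrightarrow> is_line l" and "finite W" and "m \<ge> 1"
    and pairs: "\<And>l. l \<in> L \<Longrightarrow> m \<le> card {(x, y) \<in> W. x \<noteq> y \<and> x \<in> l \<and> y \<in> l}"
  shows "finite L" "card L * m \<le> card W"
proof -
  define Q where "Q l = {(x, y) \<in> W. x \<noteq> y \<and> x \<in> l \<and> y \<in> l}" for l :: "(real ^ 'd) set"
  have QW: "Q l \<subseteq> W" for l by (auto simp: Q_def)
  have finQ: "finite (Q l)" for l using QW assms(2) by (rule finite_subset)
  have disj: "l = l'" if l: "l \<in> L" "l' \<in> L" and meet: "Q l \<inter> Q l' \<noteq> {}" for l l'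
  proof -
    obtain x y where "x \<noteq> y" "x \<in> l" "y \<in> l" "x \<in> l'" "y \<in> l'" using meet by (auto simp: Q_def)
    with l lines show ?thesis by (metis line_eq_affine_hull)
  qed
  have ne: "Q l \<noteq> {}" if "l \<in> L" for l
    using pairs[OF that] \<open>m \<ge> 1\<close> by (auto simp: Q_def[symmetric])
  have "inj_on Q L" using disj ne by (intro inj_onI) (metis Int_absorb)
  then show fin: "finite L"
    by (rule inj_on_finite[of _ _ "Pow W"]) (use QW assms(2) in auto)
  have "card L * m \<le> (\<Sum>l\<in>L. card (Q l))"
    using sum_mono[of L "\<lambda>_. m" "\<lambda>l. card (Q l)"] pairs by (simp add: Q_def)
  also have "\<dots> = card (\<Union>l\<in>L. Q l)"
    by (rule card_UN_disjoint[symmetric]) (use fin finQ disj in auto)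
  also have "\<dots> \<le> card W"
    using QW assms(2) by (intro card_mono) auto
  finally show "card L * m \<le> card W" .
qed

text \<open>Colour each point by the number of roots below it. Pairing every point with a fixed
  representative of its colour loses at most one point per colour.\<close>

lemma same_gap_pairs:
  fixes T R :: "real set" and S :: "(real \<times> real) set"
  assumes "finite T" "finite R" "card R \<le> D" "T \<inter> R = {}" "finite S"
    and S: "\<And>s t. s \<in> T \<Longrightarrow> t \<in> T \<Longrightarrow> s \<noteq> t \<Longrightarrow> closed_segment s t \<inter> R = {} \<Longrightarrow> (s, t) \<in> S"
  shows "card T \<le> card S + D + 1"
proof -
  define c where "c t = card {\<rho> \<in> R. \<rho> < t}" for t
  have gap: "{s..t} \<inter> R = {}" if "s \<in> T" "t \<in> T" "s < t" "c s = c t" for s t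
  proof (rule ccontr)
    assume "\<not> ?thesis"
    then obtain \<rho> where \<rho>: "\<rho> \<in> R" "s \<le> \<rho>" "\<rho> \<le> t" by auto
    \<comment> \<open>Roots are not in \<open>T\<close>, so \<open>\<rho>\<close> lies strictly
      between and is counted for \<open>t\<close> but not for \<open>s\<close>.\<close>
    then have "\<rho> < t" "\<not> \<rho> < s" using that assms(4) by (auto simp: less_le)
    with \<rho> that have "{\<rho> \<in> R. \<rho> < s} \<subset> {\<rho> \<in> R. \<rho> < t}" by auto
    then have "c s < c t" unfolding c_def using assms(2) by (intro psubset_card_mono) auto
    with that show False by simp
  qed
  define rep where "rep k = (SOME t. t \<in> T \<and> c t = k)" for k
  have rep: "rep (c t) \<in> T" "c (rep (c t)) = c t" if "t \<in> T" for t
    using someI[of "\<lambda>s. s \<in> T \<and> c s = c t" t] that by (auto simp: rep_def)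
  have "c t \<le> D" for t
    unfolding c_def by (rule order_trans[OF card_mono[of R]]) (use assms(2,3) in auto)
  \<comment> \<open>The colours run from 0 to \<open>D\<close>, hence \<open>D + 1\<close>
    representatives at most.\<close>
  then have "card (c ` T) \<le> card {..D}" by (intro card_mono) auto
  then have "card (rep ` c ` T) \<le> D + 1"
    using card_image_le[of "c ` T" rep] assms(1) by simp
  moreover have "card (T - rep ` c ` T) \<le> card S"
  proof (rule card_inj_on_le)
    show "inj_on (\<lambda>t. (t, rep (c t))) (T - rep ` c ` T)" by (rule inj_onI) auto
    show "(\<lambda>t. (t, rep (c t))) ` (T - rep ` c ` T) \<subseteq> S"
    proof (rule image_subsetI)
      fix t assume t: "t \<in> T - rep ` c ` T"
      then have r: "rep (c t) \<in> T" "c (rep (c t)) = c t" "t \<noteq> rep (c t)" using rep[of t] by auto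
      then have "closed_segment t (rep (c t)) \<inter> R = {}"
        using gap[of t "rep (c t)"] gap[of "rep (c t)" t] t
        by (auto simp: closed_segment_eq_real_ivl)
      then show "(t, rep (c t)) \<in> S" using t r by (intro S) auto
    qed
  qed (use assms in auto)
  moreover have "card T \<le> card (T - rep ` c ` T) + card (rep ` c ` T)"
    by (rule order_trans[OF card_mono card_Un_le]) (use assms(1) in auto)
  ultimately show ?thesis by linarith
qed

text \<open>On the line \<open>f\<close> is a non-zero polynomial with at most \<open>D\<close>
  roots. At most \<open>D\<close> points of \<open>P\<close> are lost as roots and at most
  \<open>D + 1\<close> as representatives of gaps, whence \<open>2 * D + 1\<close>.\<close>

lemma same_cell_pairs_on_line:
  fixes f :: "'d::finite mpolynomial" and l :: "(real ^ 'd) set"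
  assumes "is_line l" "finite P" "finite W" "total_degree f \<le> D" "\<not> l \<subseteq> {x. eval_mpoly f x = 0}"
    and W: "\<And>x y. x \<in> P \<Longrightarrow> y \<in> P \<Longrightarrow> \<forall>z\<in>closed_segment x y. eval_mpoly f z \<noteq> 0 \<Longrightarrow> (x, y) \<in> W"
  shows "card (l \<inter> P) \<le> card {(x, y) \<in> W. x \<noteq> y \<and> x \<in> l \<and> y \<in> l} + 2 * D + 1"
proof -
  let ?Q = "{(x, y) \<in> W. x \<noteq> y \<and> x \<in> l \<and> y \<in> l}"
  obtain a where a: "a \<in> l" using assms(5) by auto
  have "l \<noteq> {a}" using assms(1) by (auto simp: is_line_def)
  then obtain a' where a': "a' \<in> l" "a' \<noteq> a" using a by blast
  define b where "b = a' - a"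
  have "b \<noteq> 0" using a' by (simp add: b_def)
  have l: "l = range (\<lambda>t. a + t *\<^sub>R b)"
    using line_eq_affine_hull[OF assms(1) a a'(1)] a'(2) unfolding b_def affine_hull_2_alt by auto
  let ?\<gamma> = "\<lambda>t. a + t *\<^sub>R b"
  have inj: "inj_on ?\<gamma> X" for X using \<open>b \<noteq> 0\<close> by (auto simp: inj_on_def)
  obtain p where p: "Polynomial.degree p \<le> total_degree f" "\<And>t. poly p t = eval_mpoly f (?\<gamma> t)"
    using eval_mpoly_line[of f a b] by metis
  have "p \<noteq> 0"
  proof
    assume "p = 0"
    then have "eval_mpoly f (?\<gamma> t) = 0" for t using p(2)[of t] by simp
    then show False using assms(5) l by auto
  qed
  define R where "R = {t. poly p t = 0}"
  have "finite R" using \<open>p \<noteq> 0\<close> by (simp add: R_def poly_roots_finite)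
  have "card R \<le> D"
    using card_poly_roots_bound[OF \<open>p \<noteq> 0\<close>] p(1) assms(4) by (simp add: R_def)
  define T0 where "T0 = {t. ?\<gamma> t \<in> P}"
  have T0: "?\<gamma> ` T0 = l \<inter> P" by (auto simp: T0_def l)
  have finT0: "finite T0"
    using T0 assms(2) finite_imageD[OF _ inj, of T0] by (metis finite_Int)
  have cT0: "card T0 = card (l \<inter> P)" using card_image[OF inj, of T0] T0 by simp
  have "card (T0 - R) \<le> card {(s, t). (?\<gamma> s, ?\<gamma> t) \<in> ?Q} + D + 1"
  proof (rule same_gap_pairs)
    have "inj_on (\<lambda>(s, t). (?\<gamma> s, ?\<gamma> t)) UNIV" using \<open>b \<noteq> 0\<close> by (auto simp: inj_on_def)
    then have "finite ((\<lambda>(s, t). (?\<gamma> s, ?\<gamma> t)) -` ?Q)"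
      using assms(3) by (intro finite_vimageI) (auto intro: finite_subset)
    then show "finite {(s, t). (?\<gamma> s, ?\<gamma> t) \<in> ?Q}" by (simp add: vimage_def case_prod_unfold)
    fix s t assume st: "s \<in> T0 - R" "t \<in> T0 - R" "s \<noteq> t" and seg: "closed_segment s t \<inter> R = {}"
    have "(?\<gamma> s, ?\<gamma> t) \<in> W"
    proof (rule W)
      show "\<forall>z\<in>closed_segment (?\<gamma> s) (?\<gamma> t). eval_mpoly f z \<noteq> 0"
      proof
        fix z assume "z \<in> closed_segment (?\<gamma> s) (?\<gamma> t)"
        then obtain u where u: "0 \<le> u" "u \<le> 1" "z = (1 - u) *\<^sub>R ?\<gamma> s + u *\<^sub>R ?\<gamma> t"
          by (auto simp: in_segment)
        define \<tau> where "\<tau> = (1 - u) * s + u * t"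
        have "z = ?\<gamma> \<tau>" using u(3) by (simp add: \<tau>_def algebra_simps)
        moreover have "\<tau> \<in> closed_segment s t" using u by (auto simp: in_segment \<tau>_def)
        ultimately show "eval_mpoly f z \<noteq> 0" using seg p(2)[of \<tau>] by (auto simp: R_def)
      qed
    qed (use st in \<open>auto simp: T0_def\<close>)
    then show "(s, t) \<in> {(s, t). (?\<gamma> s, ?\<gamma> t) \<in> ?Q}" using st(3) \<open>b \<noteq> 0\<close> by (auto simp: l)
  qed (use finT0 \<open>finite R\<close> \<open>card R \<le> D\<close> in auto)
  moreover have "card {(s, t). (?\<gamma> s, ?\<gamma> t) \<in> ?Q} \<le> card ?Q"
  proof (rule card_inj_on_le)
    show "inj_on (\<lambda>(s, t). (?\<gamma> s, ?\<gamma> t)) {(s, t). (?\<gamma> s, ?\<gamma> t) \<in> ?Q}"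
      using \<open>b \<noteq> 0\<close> by (auto simp: inj_on_def)
    show "finite ?Q" using assms(3) by (rule finite_subset[rotated]) auto
  qed auto
  moreover have "card T0 - card R \<le> card (T0 - R)"
    using \<open>finite R\<close> by (rule diff_card_le_card_Diff)
  ultimately show ?thesis using cT0 \<open>card R \<le> D\<close> by linarith
qed

text \<open>In the bound, the factor 4 comes from \<open>r \<le> 4 * m\<close> and the base
  \<open>16 * d^2\<close> from \<open>r < 16 * d^2 * 2 ^ k\<close>.\<close>

lemma hypersurface_containing_most_lines:
  fixes P :: "(real ^ 'd) set" and L :: "(real ^ 'd) set set" and r :: nat
  defines "d \<equiv> real CARD('d)"
  assumes P: "finite P" and lines: "\<forall>l\<in>L. is_line l \<and> card (l \<inter> P) \<ge> r"
    and r: "real r \<ge> 8 * d\<^sup>2"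
  obtains H where "hypersurface_of_degree_at_most (real r / 4) H"
    "real (card {l \<in> L. \<not> l \<subseteq> H}) \<le> 4 * (16 * d\<^sup>2) ^ CARD('d) * (real (card P) ^ 2 / real r ^ (CARD('d) + 1))"
proof -
  have d1: "d \<ge> 1" by (simp add: d_def Suc_leI)
  have "d\<^sup>2 \<ge> 1" using d1 by simp
  then have r8: "real r \<ge> 8" using r by linarith
  have "\<exists>k. r < 8 * CARD('d)\<^sup>2 * 2 ^ Suc k"
  proof
    have "r < 2 ^ r" by simp
    also have "\<dots> \<le> 8 * CARD('d)\<^sup>2 * 2 ^ Suc r" by simp
    finally show "r < 8 * CARD('d)\<^sup>2 * 2 ^ Suc r" .
  qed
  \<comment> \<open>Minimality yields \<open>8 * d^2 * 2 ^ k \<le> r\<close> for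
    \<open>k > 0\<close>; for \<open>k = 0\<close> this is the lower bound assumed for
    \<open>r\<close>.\<close>
  define k where "k = (LEAST k. r < 8 * CARD('d)\<^sup>2 * 2 ^ Suc k)"
  have k1: "r < 8 * CARD('d)\<^sup>2 * 2 ^ Suc k"
    unfolding k_def by (rule LeastI_ex) fact
  have k2: "8 * CARD('d)\<^sup>2 * 2 ^ k \<le> r"
  proof (cases k)
    case 0
    have "real (8 * CARD('d)\<^sup>2) \<le> real r" using r by (simp add: d_def)
    then show ?thesis using 0 by (simp only: of_nat_le_iff) simp
  next
    case (Suc k')
    then show ?thesis using not_less_Least[of k' "\<lambda>k. r < 8 * CARD('d)\<^sup>2 * 2 ^ Suc k"] k_def by simp
  qed
  let ?J = "CARD('d) * k" and ?D = "2 * CARD('d)\<^sup>2 * 2 ^ k"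
  obtain f :: "'d mpolynomial" and C where f: "f \<noteq> 0" "total_degree f \<le> ?D"
    and C: "\<forall>j < 2 ^ ?J :: nat. C j \<subseteq> P \<and> card (C j) * 2 ^ ?J \<le> card P"
    and cover: "\<forall>x\<in>P. eval_mpoly f x \<noteq> 0 \<longrightarrow> (\<exists>j < 2 ^ ?J. x \<in> C j)"
    and seg: "\<forall>x\<in>P. \<forall>y\<in>P. (\<forall>z\<in>closed_segment x y. eval_mpoly f z \<noteq> 0) \<longrightarrow>
        (\<forall>j < 2 ^ ?J. x \<in> C j \<longleftrightarrow> y \<in> C j)"
    using polynomial_partitioning[OF P, of k] unfolding has_partition_def by (elim exE conjE) (rule that)
  define H where "H = {x. eval_mpoly f x = 0}"
  define L' where "L' = {l \<in> L. \<not> l \<subseteq> H}"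
  define W where "W = (\<Union>j < 2 ^ ?J. C j \<times> C j)"
  have D4: "4 * ?D \<le> r" using k2 by simp
  have "hypersurface_of_degree_at_most (real r / 4) H"
    unfolding hypersurface_of_degree_at_most_def
  proof (intro exI conjI)
    show "f \<noteq> 0" by fact
    show "H = {x. eval_mpoly f x = 0}" by (rule H_def)
    have "4 * total_degree f \<le> r" using f(2) D4 by linarith
    then show "real (total_degree f) \<le> real r / 4" by linarith
  qed
  moreover have "real (card L') \<le> 4 * (16 * d\<^sup>2) ^ CARD('d) * (real (card P) ^ 2 / real r ^ (CARD('d) + 1))"
  proof -
    have finC: "finite (C j)" if "j < 2 ^ ?J" for j using C that P by (meson finite_subset)
    have finW: "finite W" using finC by (auto simp: W_def)
    \<comment> \<open>From \<open>4 * ?D \<le> r\<close> and \<open>r \<ge> 8\<close> follows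
      \<open>m \<ge> r / 2 - 1 \<ge> r / 4\<close>.\<close>
    define m where "m = r - (2 * ?D + 1)"
    have m: "real r \<le> 4 * real m"
    proof -
      have "r \<le> 4 * m" using D4 r8 unfolding m_def by linarith
      then show ?thesis by linarith
    qed
    have "card L' * m \<le> card W"
    proof (rule lines_count_by_pairs(2)[OF _ finW])
      show "m \<ge> 1" using m r8 by linarith
      fix l assume l: "l \<in> L'"
      then show "is_line l" using lines by (simp add: L'_def)
      have "card (l \<inter> P) \<le> card {(x, y) \<in> W. x \<noteq> y \<and> x \<in> l \<and> y \<in> l} + 2 * ?D + 1"
      proof (rule same_cell_pairs_on_line[OF \<open>is_line l\<close> P finW f(2)])
        show "\<not> l \<subseteq> {x. eval_mpoly f x = 0}" using l by (simp add: L'_def H_def)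
        fix x y assume xy: "x \<in> P" "y \<in> P" and nz: "\<forall>z\<in>closed_segment x y. eval_mpoly f z \<noteq> 0"
        then obtain j where j: "j < 2 ^ ?J" "x \<in> C j" using cover by (meson ends_in_segment(1))
        moreover have "y \<in> C j" using seg[rule_format, OF xy _ j(1)] nz j(2) by simp
        ultimately show "(x, y) \<in> W" by (auto simp: W_def)
      qed
      moreover have "r \<le> card (l \<inter> P)" using lines l by (simp add: L'_def)
      ultimately show "m \<le> card {(x, y) \<in> W. x \<noteq> y \<and> x \<in> l \<and> y \<in> l}"
        unfolding m_def by linarith
    qed
    from of_nat_mono[OF this, where 'a = real] have 1: "real (card L') * real m \<le> real (card W)"
      by simp
    have 2: "real (card W) * 2 ^ ?J \<le> real (card P) ^ 2"
    proof -
      \<comment> \<open>Multiplying by \<open>2 ^ ?J\<close> twice turns the size bound of each cell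
        into a bound of its pairs by \<open>card P * card P\<close> without division.\<close>
      have "card W \<le> (\<Sum>j < 2 ^ ?J. card (C j \<times> C j))"
        unfolding W_def by (rule card_UN_le) simp
      then have "card W * 2 ^ ?J * 2 ^ ?J \<le> (\<Sum>j < 2 ^ ?J. card (C j \<times> C j)) * 2 ^ ?J * 2 ^ ?J"
        by simp
      also have "\<dots> = (\<Sum>j < 2 ^ ?J. (card (C j) * 2 ^ ?J) * (card (C j) * 2 ^ ?J))"
        unfolding sum_distrib_right card_cartesian_product by (intro sum.cong refl) (simp only: mult_ac)
      also have "\<dots> \<le> (\<Sum>j < 2 ^ ?J :: nat. card P * card P)"
        using C by (intro sum_mono mult_mono) auto
      finally have "card W * 2 ^ ?J \<le> card P ^ 2" by (simp add: power2_eq_square)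
      from of_nat_mono[OF this, where 'a = real] show ?thesis by simp
    qed
    have 3: "real r ^ CARD('d) \<le> (16 * d\<^sup>2) ^ CARD('d) * 2 ^ ?J"
    proof -
      have "real r \<le> real (8 * CARD('d)\<^sup>2 * 2 ^ Suc k)" using k1 by (simp only: of_nat_le_iff)
      then have "real r \<le> 16 * d\<^sup>2 * 2 ^ k" by (simp add: d_def)
      then have "real r ^ CARD('d) \<le> (16 * d\<^sup>2 * 2 ^ k) ^ CARD('d)" by (intro power_mono) auto
      also have "\<dots> = (16 * d\<^sup>2) ^ CARD('d) * 2 ^ ?J"
        by (simp add: power_mult_distrib mult.commute flip: power_mult)
      finally show ?thesis .
    qed
    have "real (card L') * real r ^ (CARD('d) + 1) = real (card L') * real r * real r ^ CARD('d)"
      by simp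
    also have "\<dots> \<le> real (card L') * (4 * real m) * ((16 * d\<^sup>2) ^ CARD('d) * 2 ^ ?J)"
      by (intro mult_mono m 3) auto
    also have "\<dots> = 4 * (16 * d\<^sup>2) ^ CARD('d) * ((real (card L') * real m) * 2 ^ ?J)"
      by (simp add: mult_ac)
    also have "\<dots> \<le> 4 * (16 * d\<^sup>2) ^ CARD('d) * (real (card W) * 2 ^ ?J)"
      using 1 by (intro mult_left_mono mult_right_mono) auto
    also have "\<dots> \<le> 4 * (16 * d\<^sup>2) ^ CARD('d) * real (card P) ^ 2"
      using 2 by (intro mult_left_mono) auto
    finally show ?thesis using r8 by (simp add: field_simps)
  qed
  ultimately show thesis using that unfolding L'_def by blast
qed

text \<open>The condition \<open>r \<ge> 2\<close> excludes \<open>r = 1\<close>, where in dimension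
  at least 2 arbitrarily many lines through a single point meet the hypothesis while the degree
  bound leaves only constant polynomials.\<close>

theorem theorem2p1:
  "\<exists>K::real. K > 0 \<and>
     (\<forall>(P :: (real ^ 'd) set) (L :: (real ^ 'd) set set) (n::nat) (r::nat).
        finite P \<and> card P = n \<and> r \<ge> 2 \<and>
        (\<forall>l\<in>L. is_line l \<and> card (l \<inter> P) \<ge> r) \<and>
        real (card L) \<ge> K * (real n ^ 2 / real r ^ (CARD('d) + 1)) \<longrightarrow>
        (\<exists>H. hypersurface_of_degree_at_most (real r / 4) H \<and>
             real (card {l \<in> L. l \<subseteq> H}) \<ge> 4 * (real n ^ 2 / real r ^ (CARD('d) + 1))))"
proof -
  define d where "d = real CARD('d)"
  \<comment> \<open>\<open>K0\<close> pays for the lines outside the hypersurface and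
    \<open>K1\<close> for small \<open>r\<close>; the extra 4 in the constant pays for the lines to
    be found.\<close>
  define K0 where "K0 = 4 * (16 * d\<^sup>2) ^ CARD('d)"
  define K1 where "K1 = (8 * d\<^sup>2) ^ (CARD('d) + 1)"
  have K01: "K0 \<ge> 0" "K1 \<ge> 0" by (auto simp: K0_def K1_def)
  show ?thesis
  proof (intro exI[of _ "K0 + K1 + 4"] conjI allI impI)
    show "K0 + K1 + 4 > 0" using K01 by linarith
    fix P :: "(real ^ 'd) set" and L :: "(real ^ 'd) set set" and n r :: nat
    define X where "X = real n ^ 2 / real r ^ (CARD('d) + 1)"
    assume "finite P \<and> card P = n \<and> r \<ge> 2 \<and> (\<forall>l\<in>L. is_line l \<and> card (l \<inter> P) \<ge> r) \<and>
      real (card L) \<ge> (K0 + K1 + 4) * (real n ^ 2 / real r ^ (CARD('d) + 1))"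
    then have P: "finite P" "card P = n" and r2: "r \<ge> 2"
      and all: "\<forall>l\<in>L. is_line l \<and> card (l \<inter> P) \<ge> r" and lines: "\<And>l. l \<in> L \<Longrightarrow> is_line l"
      and rich: "\<And>l. l \<in> L \<Longrightarrow> card (l \<inter> P) \<ge> r" and big: "real (card L) \<ge> (K0 + K1 + 4) * X"
      by (auto simp: X_def)
    have X0: "X \<ge> 0" by (simp add: X_def)
    have one: "1 \<le> card {(x, y) \<in> P \<times> P. x \<noteq> y \<and> x \<in> l \<and> y \<in> l}" if l: "l \<in> L" for l
    proof -
      have "2 \<le> card (l \<inter> P)" using rich[OF l] r2 by linarith
      then obtain x y where "x \<in> l \<inter> P" "y \<in> l \<inter> P" "x \<noteq> y"
        using P(1) card_le_Suc0_iff_eq[of "l \<inter> P"] by force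
      then have "{(x, y) \<in> P \<times> P. x \<noteq> y \<and> x \<in> l \<and> y \<in> l} \<noteq> {}" by auto
      moreover have "finite {(x, y) \<in> P \<times> P. x \<noteq> y \<and> x \<in> l \<and> y \<in> l}"
        using P by (auto intro: finite_subset[of _ "P \<times> P"])
      ultimately show ?thesis by (simp add: Suc_le_eq card_gt_0_iff)
    qed
    have finL: "finite L" and cardL: "card L \<le> n\<^sup>2"
      using lines_count_by_pairs[of L "P \<times> P" 1, OF lines] P one
      by (auto simp: card_cartesian_product power2_eq_square)
    have "\<exists>H. hypersurface_of_degree_at_most (real r / 4) H \<and> real (card {l \<in> L. l \<subseteq> H}) \<ge> 4 * X"
    proof (cases "real r \<ge> 8 * d\<^sup>2")
      case True
      obtain H where H: "hypersurface_of_degree_at_most (real r / 4) H"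
        "real (card {l \<in> L. \<not> l \<subseteq> H}) \<le> K0 * X"
        by (rule hypersurface_containing_most_lines[OF P(1) all True[unfolded d_def]])
          (rule that, simp_all add: K0_def X_def d_def P(2))
      have "card L = card {l \<in> L. l \<subseteq> H} + card {l \<in> L. \<not> l \<subseteq> H}"
        using finL by (subst card_Un_disjoint[symmetric]) (auto intro!: arg_cong[where f = card])
      then have "real (card {l \<in> L. l \<subseteq> H}) \<ge> (K0 + K1 + 4) * X - K0 * X"
        using big H(2) by linarith
      moreover have "(K0 + K1 + 4) * X - K0 * X \<ge> 4 * X"
        using mult_nonneg_nonneg[OF K01(2) X0] by (simp add: algebra_simps)
      ultimately show ?thesis using H(1) by force
    next
      case False
      \<comment> \<open>For small \<open>r\<close> this gives
        \<open>card L \<le> n^2 \<le> K1 * X\<close>, so the assumed size of \<open>L\<close> forces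
        \<open>X = 0\<close>. No lines are then required and the empty hypersurface of a constant
        suffices.\<close>
      then have "real r ^ (CARD('d) + 1) * X \<le> K1 * X"
        unfolding K1_def using X0 by (intro mult_right_mono power_mono) auto
      moreover have "real r ^ (CARD('d) + 1) * X = real n ^ 2"
        using r2 by (simp add: X_def)
      ultimately have "real n ^ 2 \<le> K1 * X" by simp
      moreover have "real (card L) \<le> real n ^ 2"
        using of_nat_mono[OF cardL, where 'a = real] by simp
      moreover have "(K0 + K1 + 4) * X = K0 * X + K1 * X + 4 * X" by (simp add: algebra_simps)
      ultimately have X: "X = 0"
        using big X0 mult_nonneg_nonneg[OF K01(1) X0] by linarith
      have "hypersurface_of_degree_at_most (real r / 4) ({} :: (real ^ 'd) set)"
        unfolding hypersurface_of_degree_at_most_def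
      proof (intro exI[of _ "1 :: 'd mpolynomial"] conjI)
        have "total_degree (1 :: 'd mpolynomial) \<le> 0"
          unfolding total_degree_le_iff by (simp add: monom_degree_def)
        then show "real (total_degree (1 :: 'd mpolynomial)) \<le> real r / 4" by simp
        show "{} = {x. eval_mpoly (1 :: 'd mpolynomial) x = 0}"
          by (simp add: eval_mpoly_def)
      qed simp
      then show ?thesis using X by (intro exI[of _ "{}"]) simp
    qed
    then show "\<exists>H. hypersurface_of_degree_at_most (real r / 4) H \<and>
        real (card {l \<in> L. l \<subseteq> H}) \<ge> 4 * (real n ^ 2 / real r ^ (CARD('d) + 1))"
      by (simp only: X_def)
  qed
qed

end
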